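(* Let $q$ be a complex number with $|q|<1$, let $P(q)=1-24\sum_{j\ge1}\frac{jq^j}{1-q^j}$, and let $$z=\prod_{j=1}^\infty\frac{(1-q^j)^4(1-q^{3j})^4}{(1-q^{2j})^2(1-q^{6j})^2},\qquad y=q\prod_{j=1}^\infty\frac{(1-q^{2j})^6(1-q^{6j})^6}{(1-q^j)^6(1-q^{3j})^6}.$$ Let $u(n)=\sum_{j=0}^n\binom nj^2\binom{2j}j\binom{2n-2j}{n-j}$ (the Domb numbers), and let $\{t(n)\}$ be defined by $t(0)=1$ and $$(n+1)^3t(n+1)=-2n(n+1)(2n+1)t(n)+16n(5n^2+1)t(n-1)-96n(n-1)(2n-1)t(n-2)\quad(n\ge0).$$ Put $Z=(1+4y)z$ and $x=\frac{y}{1+4y}$. Then in a neighborhood of $q=0$, $$Z=\tfrac12\bigl(3P(q^6)-P(q^2)\bigr)=\sum_{n=0}^\infty t(n)x^n=\sum_{n=0}^\infty(-1)^nu(n)\frac{x^n}{(1-4x)^{n+1}}=\sum_{n=0}^\infty\binom{3n}n\binom{2n}n^2x^{2n}(1-4x)^n.$$ *)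

theory Defs
  imports "HOL-Analysis.Analysis"
begin

text \<open>
  Sums and products over \<open>j \<ge> 1\<close> are indexed from \<open>0\<close> and written with \<^term>\<open>Suc j\<close>.
  They all converge for \<^term>\<open>norm q < 1\<close>, the only range where these functions are meaningful.
\<close>

definition eis_P :: "complex \<Rightarrow> complex" where
  "eis_P q = 1 - 24 * (\<Sum>j. of_nat (Suc j) * q ^ Suc j / (1 - q ^ Suc j))"

definition mod_z :: "complex \<Rightarrow> complex" where
  "mod_z q = (\<Prod>j. ((1 - q ^ Suc j) ^ 4 * (1 - q ^ (3 * Suc j)) ^ 4) /
                    ((1 - q ^ (2 * Suc j)) ^ 2 * (1 - q ^ (6 * Suc j)) ^ 2))"

definition mod_y :: "complex \<Rightarrow> complex" where
  "mod_y q = q * (\<Prod>j. ((1 - q ^ (2 * Suc j)) ^ 6 * (1 - q ^ (6 * Suc j)) ^ 6) /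
                        ((1 - q ^ Suc j) ^ 6 * (1 - q ^ (3 * Suc j)) ^ 6))"

definition mod_Z :: "complex \<Rightarrow> complex" where
  "mod_Z q = (1 + 4 * mod_y q) * mod_z q"

definition mod_x :: "complex \<Rightarrow> complex" where
  "mod_x q = mod_y q / (1 + 4 * mod_y q)"

definition domb :: "nat \<Rightarrow> nat" where
  "domb n = (\<Sum>j=0..n. (n choose j)\<^sup>2 * ((2 * j) choose j) * ((2 * n - 2 * j) choose (n - j)))"

end

theory Submission
  imports Defs "HOL-Complex_Analysis.Complex_Analysis"
begin

text \<open>
  Write \<open>\<theta> = q d/dq\<close> and \<open>s\<^sub>i = \<Sum> \<sigma>(n) q^(i n)\<close>. Liouville's elementary method evaluates
  certain sums over \<open>a x + b y = n\<close>, and hence some quadratic combinations of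
  \<open>s\<^sub>1, s\<^sub>2, s\<^sub>3, s\<^sub>6\<close>, in terms of \<open>\<theta> s\<^sub>i\<close>, \<open>s\<^sub>i\<close> and cubic divisor sums. Eliminating the
  cubic divisor sums leaves relations which say that the logarithmic derivatives of the eta
  quotients \<open>z\<close> and \<open>y z\<close> agree with those of explicit linear combinations of \<open>1\<close> and the
  \<open>s\<^sub>i\<close>; this identifies \<open>Z\<close> with the Eisenstein series. The remaining relations,
  with \<open>W = \<theta> y / y\<close> and \<open>M = \<theta> z / z\<close>, read \<open>W\<^sup>2 = z\<^sup>2 (1 + 4 y) (1 + 16 y)\<close> and
  \<open>\<theta> M = M\<^sup>2 / 2 - 4 y (1 + 8 y) z\<^sup>2\<close>. They amount to a third order linear differential equation
  for \<open>z\<close> in \<open>y\<close>, and after a change of variables for \<open>Z\<close> in \<open>x\<close> and in \<open>x\<^sup>2 (1 - 4 x)\<close>, whose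
  power series solutions are generated by the Domb numbers, by \<open>t\<close>, and by the hypergeometric
  coefficients.
\<close>

unbundle no vec_syntax

section \<open>Liouville's method\<close>

definition quads :: "nat \<Rightarrow> (nat \<times> nat \<times> nat \<times> nat) set" where
  "quads n = {(a, b, x, y). 0 < a \<and> 0 < b \<and> 0 < x \<and> 0 < y \<and> a * x + b * y = n}"

lemma finite_quads [simp]: "finite (quads n)"
proof (rule finite_subset)
  show "quads n \<subseteq> {..n} \<times> {..n} \<times> {..n} \<times> {..n}"
  proof
    fix p assume "p \<in> quads n"
    then obtain a b x y where p: "p = (a, b, x, y)" and h: "0 < a" "0 < b" "0 < x" "0 < y"
      "a * x + b * y = n" by (auto simp: quads_def)
    have "a \<le> a * x" "x \<le> a * x" "b \<le> b * y" "y \<le> b * y" using h by auto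
    with h(5) have "a \<le> n" "b \<le> n" "x \<le> n" "y \<le> n" by linarith+
    then show "p \<in> {..n} \<times> {..n} \<times> {..n} \<times> {..n}" unfolding p by simp
  qed
qed auto

text \<open>Liouville's method: subtracting \<open>b\<close> from \<open>a\<close> and adding \<open>x\<close> to \<open>y\<close> preserves
  \<open>a x + b y\<close> and exchanges the conditions \<open>b < a\<close> and \<open>x < y\<close>.\<close>

lemma sum_quads_telescope:
  fixes g t :: "nat \<Rightarrow> nat \<Rightarrow> nat \<Rightarrow> nat \<Rightarrow> 'a :: comm_ring_1"
  assumes g_sym: "\<And>a b x y. g a b x y = g b a y x"
    and t_sym: "\<And>a b x y. t a b x y = t b a y x"
    and step: "\<And>a b x y. x \<le> y \<Longrightarrow> t a b x y = g a b x y - g (a + b) b x (y - x)"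
  shows "(\<Sum>(a, b, x, y) \<in> quads n. t a b x y) =
    (\<Sum>(a, b, x, y) \<in> {(a, b, x, y) \<in> quads n. a = b}. g a b x y) -
    (\<Sum>(a, b, x, y) \<in> {(a, b, x, y) \<in> quads n. x = y}. g (a + b) b x 0)"
proof -
  let ?A = "\<lambda>r. {(a, b, x, y) \<in> quads n. r a b}"
  let ?X = "\<lambda>r. {(a, b, x, y) \<in> quads n. r x y}"
  let ?S = "\<lambda>h M. (\<Sum>(a, b, x, y) \<in> M. h a b x y) :: 'a"
  let ?g' = "\<lambda>a b x y. g (a + b) b x (y - x)"
  have fin: "finite (?A r)" "finite (?X r)" for r
    by (rule finite_subset[OF _ finite_quads[of n]]; force)+
  have splitA: "?S h (quads n) = ?S h (?A (<)) + ?S h (?A (>)) + ?S h (?A (=))" for h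
  proof -
    have q: "quads n = (?A (<) \<union> ?A (>)) \<union> ?A (=)" by auto
    show ?thesis
      by (subst q, subst sum.union_disjoint, use fin in force, use fin in force, force,
          subst sum.union_disjoint, use fin in force, use fin in force, force, simp)
  qed
  have splitX: "?S h (quads n) = ?S h (?X (<)) + ?S h (?X (>)) + ?S h (?X (=))" for h
  proof -
    have q: "quads n = (?X (<) \<union> ?X (>)) \<union> ?X (=)" by auto
    show ?thesis
      by (subst q, subst sum.union_disjoint, use fin in force, use fin in force, force,
          subst sum.union_disjoint, use fin in force, use fin in force, force, simp)
  qed
  have swapX: "?S h (?X (>)) = ?S h (?X (<))" if "\<And>a b x y. h a b x y = h b a y x" for h
    by (rule sum.reindex_bij_witness[where i = "\<lambda>(a, b, x, y). (b, a, y, x)"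
          and j = "\<lambda>(a, b, x, y). (b, a, y, x)"]) (auto simp: quads_def add.commute that)
  have swapA: "?S h (?A (<)) = ?S h (?A (>))" if "\<And>a b x y. h a b x y = h b a y x" for h
    by (rule sum.reindex_bij_witness[where i = "\<lambda>(a, b, x, y). (b, a, y, x)"
          and j = "\<lambda>(a, b, x, y). (b, a, y, x)"]) (auto simp: quads_def add.commute that)
  have eqA: "(a - b) * x + b * (x + y) = a * x + b * y" if "b < a" for a b x y :: nat
  proof -
    from that obtain k where "a = b + k" by (auto dest: less_imp_add_positive)
    then show ?thesis by (simp add: algebra_simps)
  qed
  have eqX: "(a + b) * x + b * (y - x) = a * x + b * y" if "x < y" for a b x y :: nat
  proof -
    from that obtain k where "y = x + k" by (auto dest: less_imp_add_positive)
    then show ?thesis by (simp add: algebra_simps)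
  qed
  have shift: "?S g (?A (>)) = ?S ?g' (?X (<))"
    by (rule sum.reindex_bij_witness[where i = "\<lambda>(a, b, x, y). (a + b, b, x, y - x)"
          and j = "\<lambda>(a, b, x, y). (a - b, b, x, x + y)"])
       (auto simp: quads_def eqA eqX)
  have lt: "?S t (?X (<)) = ?S g (?X (<)) - ?S ?g' (?X (<))"
    unfolding sum_subtractf[symmetric] by (rule sum.cong) (auto simp: step)
  have eq: "?S t (?X (=)) = ?S g (?X (=)) - ?S (\<lambda>a b x y. g (a + b) b x 0) (?X (=))"
    unfolding sum_subtractf[symmetric] by (rule sum.cong) (auto simp: step)
  \<comment> \<open>The cases \<open>x < y\<close> and \<open>x > y\<close> contribute equally by
    symmetry. The sum of \<open>g\<close> over all quadruples is then split again by comparing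
    \<open>a\<close> with \<open>b\<close>; by \<open>shift\<close> its two off-diagonal parts
    cancel both sums of \<open>?g'\<close>, and only the diagonals survive.\<close>
  have "?S t (quads n) = (?S g (?X (<)) + ?S g (?X (<)) + ?S g (?X (=)))
      - (?S ?g' (?X (<)) + ?S ?g' (?X (<))) - ?S (\<lambda>a b x y. g (a + b) b x 0) (?X (=))"
    by (subst splitX, subst swapX[OF t_sym], simp only: lt eq) (simp add: algebra_simps)
  also have "?S g (?X (<)) + ?S g (?X (<)) + ?S g (?X (=)) = ?S g (quads n)"
    by (simp only: splitX[of g] swapX[OF g_sym])
  also have "\<dots> = ?S ?g' (?X (<)) + ?S ?g' (?X (<)) + ?S g (?A (=))"
    by (simp only: splitA[of g] swapA[OF g_sym] shift)
  finally show ?thesis by simp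
qed

text \<open>Needed for the \<open>I 0\<close> term of Liouville's identity: it is the sum of
  \<open>a * b\<close> over positive \<open>a\<close>, \<open>b\<close> with
  \<open>a + b = m\<close>.\<close>

lemma sum_of_nat_mult_diff:
  fixes m :: nat
  shows "(\<Sum>b\<in>{0<..<m}. of_nat m * of_nat b - of_nat b ^ 2) = (of_nat m ^ 3 - of_nat m :: complex) / 6"
proof -
  have 1: "(\<Sum>b<k. of_nat b) = (of_nat k ^ 2 - of_nat k :: complex) / 2" for k :: nat
    by (induction k) (simp_all add: field_simps power2_eq_square)
  have 2: "(\<Sum>b<k. of_nat b ^ 2) = (2 * of_nat k ^ 3 - 3 * of_nat k ^ 2 + of_nat k :: complex) / 6" for k :: nat
    by (induction k) (simp_all add: field_simps power2_eq_square power3_eq_cube)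
  have "(\<Sum>b\<in>{0<..<m}. of_nat m * of_nat b - of_nat b ^ 2 :: complex) =
      (\<Sum>b<m. of_nat m * of_nat b - of_nat b ^ 2)"
    by (rule sum.mono_neutral_left) auto
  also have "\<dots> = of_nat m * (\<Sum>b<m. of_nat b) - (\<Sum>b<m. of_nat b ^ 2)"
    by (simp only: sum_subtractf sum_distrib_left)
  finally show ?thesis
    unfolding 1 2 by (simp add: field_simps power2_eq_square power3_eq_cube)
qed

text \<open>On this diagonal the equation reads \<open>d * (x + y) = n\<close>, so \<open>d\<close>
  divides \<open>n\<close> and \<open>x\<close> ranges freely below \<open>n div d\<close>.\<close>

lemma sum_quads_eq_left:
  fixes h :: "nat \<Rightarrow> nat \<Rightarrow> nat \<Rightarrow> 'a :: comm_monoid_add"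
  assumes "n > 0"
  shows "(\<Sum>(a, b, x, y) \<in> {(a, b, x, y) \<in> quads n. a = b}. h a x y) =
         (\<Sum>d | d dvd n. \<Sum>x\<in>{0<..<n div d}. h d x (n div d - x))"
proof -
  have "(\<Sum>(a, b, x, y) \<in> {(a, b, x, y) \<in> quads n. a = b}. h a x y) =
     (\<Sum>(d, x) \<in> Sigma {d. d dvd n} (\<lambda>d. {0<..<n div d}). h d x (n div d - x))"
  proof (rule sum.reindex_bij_witness[where i = "\<lambda>(d, x). (d, d, x, n div d - x)"
          and j = "\<lambda>(a, b, x, y). (a, x)"])
  qed (use assms in \<open>auto simp: quads_def simp flip: distrib_left dest: dvd_pos_nat\<close>)
  then show ?thesis using assms by (simp add: sum.Sigma)
qed

lemma sum_quads_eq_right: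
  fixes h :: "nat \<Rightarrow> nat \<Rightarrow> nat \<Rightarrow> 'a :: comm_monoid_add"
  assumes "n > 0"
  shows "(\<Sum>(a, b, x, y) \<in> {(a, b, x, y) \<in> quads n. x = y}. h a b x) =
         (\<Sum>d | d dvd n. \<Sum>b\<in>{0<..<n div d}. h b (n div d - b) d)"
proof -
  have "(\<Sum>(a, b, x, y) \<in> {(a, b, x, y) \<in> quads n. x = y}. h a b x) =
        (\<Sum>(a, b, x, y) \<in> {(a, b, x, y) \<in> quads n. a = b}. h x y a)"
    by (rule sum.reindex_bij_witness[where i = "\<lambda>(a, b, x, y). (x, y, a, b)"
          and j = "\<lambda>(a, b, x, y). (x, y, a, b)"]) (auto simp: quads_def mult.commute)
  then show ?thesis using sum_quads_eq_left[OF assms, of "\<lambda>a x y. h x y a"] by simp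
qed

text \<open>\<open>sum_quads_telescope\<close> applied to a quadratic form in \<open>a\<close> and
  \<open>b\<close>. With truncated subtraction, \<open>x - y + (y - x)\<close> is the distance of
  \<open>x\<close> and \<open>y\<close>.\<close>

theorem Liouville_identity:
  fixes I :: "nat \<Rightarrow> complex"
  assumes n: "n > 0"
  shows "(\<Sum>(a, b, x, y) \<in> quads n. of_nat a * of_nat b *
           (I (x + y) + I (x - y + (y - x)) - 2 * I x - 2 * I y)) =
    (\<Sum>m | m dvd n. (of_nat n * of_nat m - of_nat m ^ 3) * I (n div m)
                   + I 0 * (of_nat m ^ 3 - of_nat m) / 6)"
proof -
  \<comment> \<open>For \<open>x \<le> y\<close>, the substitution leaves the coefficients of
    \<open>a^2\<close> and \<open>b^2\<close> in this form unchanged and lowers that of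
    \<open>a * b\<close> by exactly the bracket in \<open>t\<close>.\<close>
  define g where "g = (\<lambda>a b x y. I x * of_nat a ^ 2 + I y * of_nat b ^ 2 +
      (I (x + y) - I x - I y) * of_nat a * of_nat b)"
  define t where "t = (\<lambda>a b x y. of_nat a * of_nat b *
           (I (x + y) + I (x - y + (y - x)) - 2 * I x - 2 * I y))"
  have 1: "(\<Sum>(a, b, x, y) \<in> quads n. t a b x y) =
    (\<Sum>(a, b, x, y) \<in> {(a, b, x, y) \<in> quads n. a = b}. g a b x y) -
    (\<Sum>(a, b, x, y) \<in> {(a, b, x, y) \<in> quads n. x = y}. g (a + b) b x 0)"
    by (rule sum_quads_telescope) (simp_all add: g_def t_def algebra_simps power2_eq_square)
  have 2: "(\<Sum>(a, b, x, y) \<in> {(a, b, x, y) \<in> quads n. a = b}. g a b x y) =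
    (\<Sum>d | d dvd n. (of_nat n * of_nat d - of_nat d ^ 2) * I (n div d))"
  proof -
    \<comment> \<open>For \<open>a = b\<close> the terms with \<open>I x\<close> and
      \<open>I y\<close> cancel.\<close>
    have "(\<Sum>(a, b, x, y) \<in> {(a, b, x, y) \<in> quads n. a = b}. g a b x y) =
       (\<Sum>(a, b, x, y) \<in> {(a, b, x, y) \<in> quads n. a = b}. of_nat a ^ 2 * I (x + y))"
      by (rule sum.cong) (auto simp: g_def algebra_simps power2_eq_square)
    also have "\<dots> = (\<Sum>d | d dvd n. \<Sum>x\<in>{0<..<n div d}. of_nat d ^ 2 * I (n div d))"
      by (subst sum_quads_eq_left[OF n]) (intro sum.cong, auto)
    also have "\<dots> = (\<Sum>d | d dvd n. (of_nat n * of_nat d - of_nat d ^ 2) * I (n div d))"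
    proof (intro sum.cong refl)
      fix d assume "d \<in> {d. d dvd n}"
      then obtain m where m: "n = d * m" by auto
      with n show "(\<Sum>x\<in>{0<..<n div d}. of_nat d ^ 2 * I (n div d)) =
         (of_nat n * of_nat d - of_nat d ^ 2) * I (n div d)"
        by (simp add: of_nat_diff algebra_simps power2_eq_square)
    qed
    finally show ?thesis .
  qed
  have 3: "(\<Sum>(a, b, x, y) \<in> {(a, b, x, y) \<in> quads n. x = y}. g (a + b) b x 0) =
    (\<Sum>m | m dvd n. (of_nat m ^ 3 - of_nat m ^ 2) * I (n div m) - I 0 * (of_nat m ^ 3 - of_nat m) / 6)"
  proof -
    \<comment> \<open>With last argument 0 the form reduces to a square times \<open>I x\<close> and
      a cross term with \<open>I 0\<close>, the origin of the \<open>I 0\<close> term on the right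
      of the identity.\<close>
    have "(\<Sum>(a, b, x, y) \<in> {(a, b, x, y) \<in> quads n. x = y}. g (a + b) b x 0) =
       (\<Sum>(a, b, x, y) \<in> {(a, b, x, y) \<in> quads n. x = y}. of_nat (a + b) ^ 2 * I x - I 0 * of_nat a * of_nat b)"
      by (rule sum.cong) (auto simp: g_def algebra_simps power2_eq_square)
    also have "\<dots> = (\<Sum>d | d dvd n. \<Sum>b\<in>{0<..<n div d}. of_nat (n div d) ^ 2 * I d -
        I 0 * (of_nat (n div d) * of_nat b - of_nat b ^ 2))"
      by (subst sum_quads_eq_right[OF n, of "\<lambda>a b x. of_nat (a + b) ^ 2 * I x - I 0 * of_nat a * of_nat b"])
         (intro sum.cong, auto simp: of_nat_diff algebra_simps power2_eq_square)
    \<comment> \<open>Passing to the complementary divisor gives both diagonal sums the same index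
      and the same argument \<open>n div m\<close> of \<open>I\<close>.\<close>
    also have "\<dots> = (\<Sum>m | m dvd n. \<Sum>b\<in>{0<..<m}. of_nat m ^ 2 * I (n div m) -
        I 0 * (of_nat m * of_nat b - of_nat b ^ 2))"
      by (rule sum.reindex_bij_witness[where i = "\<lambda>d. n div d" and j = "\<lambda>d. n div d"])
         (use n in auto)
    also have "\<dots> = (\<Sum>m | m dvd n. (of_nat m ^ 3 - of_nat m ^ 2) * I (n div m) - I 0 * (of_nat m ^ 3 - of_nat m) / 6)"
    proof (intro sum.cong refl)
      fix m assume "m \<in> {m. m dvd n}"
      then have "m > 0" using n by (auto intro: Nat.gr0I)
      then have "(\<Sum>b\<in>{0<..<m}. of_nat m ^ 2 * I (n div m)) = (of_nat m ^ 3 - of_nat m ^ 2) * I (n div m)"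
        by (simp add: of_nat_diff algebra_simps power2_eq_square power3_eq_cube)
      then show "(\<Sum>b\<in>{0<..<m}. of_nat m ^ 2 * I (n div m) - I 0 * (of_nat m * of_nat b - of_nat b ^ 2)) =
        (of_nat m ^ 3 - of_nat m ^ 2) * I (n div m) - I 0 * (of_nat m ^ 3 - of_nat m) / 6"
        by (subst sum_subtractf, subst sum_distrib_left[symmetric]) (simp only: sum_of_nat_mult_diff times_divide_eq_right)
    qed
    finally show ?thesis .
  qed
  have "(\<Sum>(a, b, x, y) \<in> quads n. t a b x y) = (\<Sum>m | m dvd n.
      (of_nat n * of_nat m - of_nat m ^ 2) * I (n div m) - ((of_nat m ^ 3 - of_nat m ^ 2) * I (n div m)
        - I 0 * (of_nat m ^ 3 - of_nat m) / 6))"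
    unfolding 1 2 3 by (rule sum_subtractf[symmetric])
  also have "\<dots> = (\<Sum>m | m dvd n. (of_nat n * of_nat m - of_nat m ^ 3) * I (n div m)
                   + I 0 * (of_nat m ^ 3 - of_nat m) / 6)"
    by (rule sum.cong) (simp_all add: left_diff_distrib)
  finally show ?thesis unfolding t_def .
qed

section \<open>Convolution sums of divisor functions\<close>

text \<open>The Lambert series with terms \<open>m^e * I k * q^(m * k)\<close> for \<open>m\<close>,
  \<open>k\<close> \<ge> 1. Index 0 is set apart because every natural number divides 0.\<close>

definition lambert_fps :: "nat \<Rightarrow> (nat \<Rightarrow> complex) \<Rightarrow> complex fps" where
  "lambert_fps e I = Abs_fps (\<lambda>n. if n = 0 then 0 else \<Sum>m | m dvd n. of_nat m ^ e * I (n div m))"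

lemma lambert_fps_nth:
  "lambert_fps e I $ n = (if n = 0 then 0 else \<Sum>m | m dvd n. of_nat m ^ e * I (n div m))"
  by (simp add: lambert_fps_def)

lemma quads_0 [simp]: "quads 0 = {}"
  by (auto simp: quads_def)

text \<open>A quadruple amounts to a splitting of \<open>n\<close> into \<open>i\<close> and
  \<open>n - i\<close> with a divisor \<open>a\<close> of \<open>i\<close> and a divisor
  \<open>b\<close> of \<open>n - i\<close>; \<open>x\<close> and \<open>y\<close> are the
  cofactors.\<close>

lemma lambert_fps_nth_mult:
  "(lambert_fps 1 f * lambert_fps 1 g) $ n =
     (\<Sum>(a, b, x, y) \<in> quads n. of_nat a * of_nat b * (f x * g y))"
proof -
  have pos: "0 < b \<and> 0 < (n - a) div b" if "b dvd n - a" "a < n" for a b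
    using that dvd_pos_nat[of "n - a" b] by (auto simp: div_greater_zero_iff intro: dvd_imp_le)
  have "(lambert_fps 1 f * lambert_fps 1 g) $ n =
      (\<Sum>i\<in>{0..n}. lambert_fps 1 f $ i * lambert_fps 1 g $ (n - i))"
    by (simp add: fps_mult_nth)
  also have "\<dots> = (\<Sum>i\<in>{0<..<n}. lambert_fps 1 f $ i * lambert_fps 1 g $ (n - i))"
    by (rule sum.mono_neutral_right) (auto simp: lambert_fps_nth)
  also have "\<dots> = (\<Sum>i\<in>{0<..<n}. \<Sum>(a, b)\<in>{a. a dvd i} \<times> {b. b dvd n - i}.
      of_nat a * f (i div a) * (of_nat b * g ((n - i) div b)))"
    by (intro sum.cong refl) (auto simp: lambert_fps_nth sum_product sum.cartesian_product)
  also have "\<dots> = (\<Sum>(i, a, b)\<in>Sigma {0<..<n} (\<lambda>i. {a. a dvd i} \<times> {b. b dvd n - i}).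
      of_nat a * f (i div a) * (of_nat b * g ((n - i) div b)))"
    by (subst sum.Sigma) (auto simp: case_prod_unfold)
  also have "\<dots> = (\<Sum>(a, b, x, y) \<in> quads n. of_nat a * of_nat b * (f x * g y))"
  proof (rule sum.reindex_bij_witness[where j = "\<lambda>(i, a, b). (a, b, i div a, (n - i) div b)"
          and i = "\<lambda>(a, b, x, y). (a * x, a, b)"])
  qed (use pos in \<open>auto simp: quads_def dest: dvd_pos_nat\<close>)
  finally show ?thesis .
qed

text \<open>The indicator keeps the \<open>m\<close> with \<open>i * m\<close> dividing
  \<open>n\<close>, so this is the generating series of \<sigma>_e dilated by q -> q^i:
  \<open>s\<^sub>i\<close> for \<open>e = 1\<close>, the cubic divisor sums for
  \<open>e = 3\<close>.\<close>

abbreviation div_sum :: "nat \<Rightarrow> nat \<Rightarrow> complex fps" where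
  "div_sum e i \<equiv> lambert_fps e (\<lambda>x. of_bool (i dvd x))"

definition theta :: "complex fps \<Rightarrow> complex fps" where
  "theta f = fps_X * fps_deriv f"

lemma theta_nth [simp]: "theta f $ n = of_nat n * f $ n"
  by (cases n) (simp_all add: theta_def)

text \<open>Liouville's identity for the indicator of the multiples of \<open>i\<close>. The factor
  \<open>n\<close> becomes \<theta>, \<open>I 0 = 1\<close> contributes the undilated series, and 6
  clears the denominator.\<close>

lemma Liouville_fps:
  fixes i :: nat and n :: nat
  shows "6 * (\<Sum>(a, b, x, y) \<in> quads n. of_nat a * of_nat b *
     (of_bool (i dvd x + y) + of_bool (i dvd x - y + (y - x)) - 2 * of_bool (i dvd x) - 2 * of_bool (i dvd y)))
   = (6 * theta (div_sum 1 i) - 6 * div_sum 3 i + div_sum 3 1 - div_sum 1 1) $ n"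
proof (cases "n = 0")
  case True
  then show ?thesis by (simp add: lambert_fps_nth)
next
  case False
  have "6 * (\<Sum>(a, b, x, y) \<in> quads n. of_nat a * of_nat b *
     (of_bool (i dvd x + y) + of_bool (i dvd x - y + (y - x)) - 2 * of_bool (i dvd x) - 2 * of_bool (i dvd y)))
     = 6 * (\<Sum>m | m dvd n. (of_nat n * of_nat m - of_nat m ^ 3) * of_bool (i dvd n div m)
                   + of_bool (i dvd 0) * (of_nat m ^ 3 - of_nat m) / 6 :: complex)"
    using False by (subst Liouville_identity[where I = "\<lambda>x. of_bool (i dvd x)"]) simp_all
  also have "\<dots> = (\<Sum>m | m dvd n. 6 * (of_nat n * (of_nat m * of_bool (i dvd n div m))) -
      6 * (of_nat m ^ 3 * of_bool (i dvd n div m)) + of_nat m ^ 3 - of_nat m)"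
    unfolding sum_distrib_left by (rule sum.cong) (simp_all add: field_simps)
  also have "\<dots> = (6 * theta (div_sum 1 i) - 6 * div_sum 3 i + div_sum 3 1 - div_sum 1 1) $ n"
    using False by (simp add: lambert_fps_nth sum.distrib sum_subtractf sum_distrib_left
        del: sum_mult_of_bool_eq sum_of_bool_mult_eq)
  finally show ?thesis .
qed

section \<open>Divisibility indicators modulo 2, 3 and 6, and the resulting convolutions\<close>

lemma of_bool_dvd_2: 
  "of_bool (2 dvd x + y) + of_bool (2 dvd x - y + (y - x)) = 
    (2 * (1 - of_bool (2 dvd x) - of_bool (2 dvd y) + 2 * (of_bool (2 dvd x) * of_bool (2 dvd y))) :: complex)"
  for x y :: nat
proof -
  have "2 dvd x + y \<longleftrightarrow> (2 dvd x \<longleftrightarrow> 2 dvd y)" "2 dvd x - y + (y - x) \<longleftrightarrow> (2 dvd x \<longleftrightarrow> 2 dvd y)"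
    by presburger+
  then show ?thesis by simp
qed

text \<open>If 3 divides neither \<open>x\<close> nor \<open>y\<close>, it divides exactly one of
  their sum and distance. So the two indicators add up to a polynomial in those of \<open>x\<close>
  and \<open>y\<close>, though neither is one by itself; this turns the Liouville sum into products
  of Lambert series.\<close>

lemma of_bool_dvd_3: 
  "of_bool (3 dvd x + y) + of_bool (3 dvd x - y + (y - x)) = 
    (1 - of_bool (3 dvd x) - of_bool (3 dvd y) + 3 * (of_bool (3 dvd x) * of_bool (3 dvd y)) :: complex)"
  for x y :: nat
proof -
  have *: "3 dvd x \<Longrightarrow> (3 dvd x + y \<longleftrightarrow> 3 dvd y) \<and> (3 dvd x - y + (y - x) \<longleftrightarrow> 3 dvd y)"
     "3 dvd y \<Longrightarrow> (3 dvd x + y \<longleftrightarrow> 3 dvd x) \<and> (3 dvd x - y + (y - x) \<longleftrightarrow> 3 dvd x)"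
     "\<not> 3 dvd x \<Longrightarrow> \<not> 3 dvd y \<Longrightarrow> (3 dvd x - y + (y - x) \<longleftrightarrow> \<not> 3 dvd x + y)"
    by presburger+
  show ?thesis 
    by (cases "3 dvd x"; cases "3 dvd y") (simp_all add: *)
qed

text \<open>Modulo 2 both conditions agree, so the parity factor comes out and the sum of the two
  indicators modulo 3 remains.\<close>

lemma of_bool_dvd_6: 
  "of_bool (6 dvd x + y) + of_bool (6 dvd x - y + (y - x)) = 
    ((1 - of_bool (2 dvd x) - of_bool (2 dvd y) + 2 * (of_bool (2 dvd x) * of_bool (2 dvd y)))
   * (1 - of_bool (3 dvd x) - of_bool (3 dvd y) + 3 * (of_bool (3 dvd x) * of_bool (3 dvd y))) :: complex)"
  for x y :: nat
proof -
  have 6: "6 dvd k \<longleftrightarrow> 2 dvd k \<and> 3 dvd k" for k :: nat by presburger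
  have "2 dvd x + y \<longleftrightarrow> (2 dvd x \<longleftrightarrow> 2 dvd y)" "2 dvd x - y + (y - x) \<longleftrightarrow> (2 dvd x \<longleftrightarrow> 2 dvd y)"
    by presburger+
  then have "of_bool (6 dvd x + y) + of_bool (6 dvd x - y + (y - x)) = 
     of_bool (2 dvd x \<longleftrightarrow> 2 dvd y) * (of_bool (3 dvd x + y) + of_bool (3 dvd x - y + (y - x)) :: complex)"
    unfolding 6 by simp
  then show ?thesis unfolding of_bool_dvd_3 by auto
qed

text \<open>For \<open>i = 1\<close> every indicator is 1 and the bracket is the constant
  -2.\<close>

lemma div_sum_convolution_1:
  "12 * (div_sum 1 1 * div_sum 1 1) = 5 * div_sum 3 1 + div_sum 1 1 - 6 * theta (div_sum 1 1)"
proof (rule fps_ext)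
  fix n
  have "(12 * (div_sum 1 1 * div_sum 1 1)) $ n =
     - (6 * (\<Sum>(a, b, x, y) \<in> quads n. of_nat a * of_nat b *
     (of_bool (1 dvd x + y) + of_bool (1 dvd x - y + (y - x)) - 2 * of_bool (1 dvd x) - 2 * of_bool (1 dvd y))))"
    by (simp only: fps_mult_numeral_left lambert_fps_nth_mult sum_distrib_left case_prod_unfold
        sum_negf[symmetric])
       (rule sum.cong, simp_all)
  then show "(12 * (div_sum 1 1 * div_sum 1 1)) $ n =
      (5 * div_sum 3 1 + div_sum 1 1 - 6 * theta (div_sum 1 1)) $ n"
    unfolding Liouville_fps by simp
qed

lemma div_sum_convolution_2:
  "12 * (div_sum 1 1 * div_sum 1 1) - 48 * (div_sum 1 1 * div_sum 1 2) + 24 * (div_sum 1 2 * div_sum 1 2) =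
    6 * theta (div_sum 1 2) - 6 * div_sum 3 2 + div_sum 3 1 - div_sum 1 1"
  (is "?l = ?r")
proof (rule fps_ext)
  fix n
  \<comment> \<open>The mixed product is split evenly into its two orders, because the indicator of
    \<open>x\<close> and that of \<open>y\<close> occur as separate terms.\<close>
  have "?l $ n = (12 * (div_sum 1 1 * div_sum 1 1) - 24 * (div_sum 1 1 * div_sum 1 2)
      - 24 * (div_sum 1 2 * div_sum 1 1) + 24 * (div_sum 1 2 * div_sum 1 2)) $ n"
    by (simp add: mult.commute)
  also have "\<dots> = 6 * (\<Sum>(a, b, x, y) \<in> quads n. of_nat a * of_nat b *
     (of_bool (2 dvd x + y) + of_bool (2 dvd x - y + (y - x)) - 2 * of_bool (2 dvd x) - 2 * of_bool (2 dvd y)))"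
    unfolding of_bool_dvd_2
    by (simp only: fps_mult_numeral_left lambert_fps_nth_mult sum_distrib_left case_prod_unfold fps_sub_nth fps_add_nth
        sum.distrib[symmetric] sum_subtractf[symmetric])
       (rule sum.cong, simp_all add: algebra_simps)
  finally show "?l $ n = ?r $ n"
    unfolding Liouville_fps .
qed

lemma div_sum_convolution_3:
  "6 * (div_sum 1 1 * div_sum 1 1) - 36 * (div_sum 1 1 * div_sum 1 3) + 18 * (div_sum 1 3 * div_sum 1 3) =
    6 * theta (div_sum 1 3) - 6 * div_sum 3 3 + div_sum 3 1 - div_sum 1 1"
  (is "?l = ?r")
proof (rule fps_ext)
  fix n
  have "?l $ n = (6 * (div_sum 1 1 * div_sum 1 1) - 18 * (div_sum 1 1 * div_sum 1 3)
      - 18 * (div_sum 1 3 * div_sum 1 1) + 18 * (div_sum 1 3 * div_sum 1 3)) $ n"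
    by (simp add: mult.commute)
  also have "\<dots> = 6 * (\<Sum>(a, b, x, y) \<in> quads n. of_nat a * of_nat b *
     (of_bool (3 dvd x + y) + of_bool (3 dvd x - y + (y - x)) - 2 * of_bool (3 dvd x) - 2 * of_bool (3 dvd y)))"
    unfolding of_bool_dvd_3
    by (simp only: fps_mult_numeral_left lambert_fps_nth_mult sum_distrib_left case_prod_unfold fps_sub_nth fps_add_nth
        sum.distrib[symmetric] sum_subtractf[symmetric])
       (rule sum.cong, simp_all add: algebra_simps)
  finally show "?l $ n = ?r $ n"
    unfolding Liouville_fps .
qed

lemma div_sum_convolution_6:
  defines "s \<equiv> div_sum 1"
  shows "6 * (s 1 * s 1) - 12 * (s 1 * s 3) + 18 * (s 3 * s 3) - 12 * (s 1 * s 2) - 12 * (s 1 * s 6)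
     + 12 * (s 2 * s 3) - 36 * (s 3 * s 6) + 12 * (s 2 * s 2) - 24 * (s 2 * s 6) + 36 * (s 6 * s 6) =
    6 * theta (s 6) - 6 * div_sum 3 6 + div_sum 3 1 - s 1"
  (is "?l = ?r")
proof (rule fps_ext)
  fix n
  \<comment> \<open>Expanding the product in \<open>of_bool_dvd_6\<close> yields indicators of 2 and
    of 3 for the same variable; they merge into that of 6, so no further dilations arise.\<close>
  have 6: "of_bool (6 dvd k) = (of_bool (2 dvd k) * of_bool (3 dvd k) :: complex)" for k :: nat
  proof -
    have "6 dvd k \<longleftrightarrow> 2 dvd k \<and> 3 dvd k" by presburger
    then show ?thesis by simp
  qed
  have "?l $ n = (6 * (s 1 * s 1) - 6 * (s 1 * s 3) - 6 * (s 3 * s 1) + 18 * (s 3 * s 3) - 6 * (s 1 * s 2)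
     - 6 * (s 2 * s 1) - 6 * (s 1 * s 6) - 6 * (s 6 * s 1)
     + 6 * (s 2 * s 3) + 6 * (s 3 * s 2) - 18 * (s 3 * s 6) - 18 * (s 6 * s 3) + 12 * (s 2 * s 2)
     - 12 * (s 2 * s 6) - 12 * (s 6 * s 2) + 36 * (s 6 * s 6)) $ n"
    by (simp add: mult.commute)
  also have "\<dots> = 6 * (\<Sum>(a, b, x, y) \<in> quads n. of_nat a * of_nat b *
     (of_bool (6 dvd x + y) + of_bool (6 dvd x - y + (y - x)) - 2 * of_bool (6 dvd x) - 2 * of_bool (6 dvd y)))"
    unfolding of_bool_dvd_6 s_def
    by (simp only: fps_mult_numeral_left lambert_fps_nth_mult sum_distrib_left case_prod_unfold fps_sub_nth fps_add_nth
        sum.distrib[symmetric] sum_subtractf[symmetric])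
       (rule sum.cong, simp_all add: 6 algebra_simps)
  finally show "?l $ n = ?r $ n"
    unfolding Liouville_fps s_def .
qed

section \<open>Quadratic relations and differential equations\<close>

lemma theta_add [simp]: "theta (f + g) = theta f + theta g"
  and theta_diff [simp]: "theta (f - g) = theta f - theta g"
  and theta_uminus [simp]: "theta (- f) = - theta f"
  and theta_mult: "theta (f * g) = theta f * g + f * theta g"
  and theta_numeral [simp]: "theta (numeral k) = 0"
  and theta_1 [simp]: "theta 1 = 0"
  and theta_0 [simp]: "theta 0 = 0"
  and theta_X: "theta fps_X = fps_X"
  by (simp_all add: theta_def algebra_simps)

lemma theta_numeral_mult [simp]: "theta (numeral k * f) = numeral k * theta f"
  by (simp add: theta_mult)

lemma theta_mult_numeral [simp]: "theta (f * numeral k) = theta f * numeral k"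
  by (simp add: theta_mult)

lemma theta_power2: "theta (f ^ 2) = 2 * f * theta f"
  by (simp add: power2_eq_square theta_mult algebra_simps)

text \<open>The chain rule with \<open>r\<close> as logarithmic derivative of \<open>v\<close>: on
  series in \<open>v\<close>, \<theta> acts as \<open>r\<close> times the Euler operator in
  \<open>v\<close>.\<close>

lemma theta_compose:
  assumes "v $ 0 = 0" "theta v = v * r"
  shows "theta (f oo v) = (theta f oo v) * r"
proof -
  have "theta (f oo v) = (fps_deriv f oo v) * theta v"
    using assms by (simp add: theta_def fps_compose_deriv algebra_simps)
  then show ?thesis
    using assms by (simp add: theta_def fps_compose_mult_distrib algebra_simps)
qed

lemma theta_compose_X_power:
  assumes "k > 0"
  shows "theta (f oo fps_X ^ k) = of_nat k * (theta f oo fps_X ^ k)"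
proof -
  have "theta (fps_X ^ k) = fps_X ^ k * of_nat k"
    by (rule fps_ext) (auto simp: mult.commute[of _ "of_nat k"] simp flip: fps_of_nat)
  from theta_compose[OF _ this] assms show ?thesis by (simp add: algebra_simps)
qed

lemma div_sum_compose:
  assumes "k > 0"
  shows "div_sum e i oo fps_X ^ k = div_sum e (i * k)"
proof (rule fps_ext)
  fix n
  show "(div_sum e i oo fps_X ^ k) $ n = div_sum e (i * k) $ n"
  proof (cases "k dvd n")
    case True
    then obtain n' where n: "n = k * n'" by auto
    have "m dvd n' \<and> i dvd n' div m \<longleftrightarrow> m dvd n \<and> i * k dvd n div m" if "n > 0" for m
    proof
      assume *: "m dvd n' \<and> i dvd n' div m"
      then obtain a where a: "n' = m * a" by auto
      with * that n have "m > 0" "i dvd a" by auto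
      with a n show "m dvd n \<and> i * k dvd n div m" by (simp add: mult.left_commute[of k m] mult.commute[of i k])
    next
      assume *: "m dvd n \<and> i * k dvd n div m"
      then have "m > 0" using that by (auto intro: Nat.gr0I)
      from * obtain b where "n div m = i * k * b" unfolding dvd_def by blast
      with * have "n = m * (i * k * b)" by (metis dvd_mult_div_cancel)
      with n assms have "n' = m * (i * b)" by (simp add: mult_ac)
      then show "m dvd n' \<and> i dvd n' div m" using n that by (cases "m = 0") auto
    qed
    then have "(\<Sum>m | m dvd n'. of_nat m ^ e * of_bool (i dvd n' div m)) =
        (\<Sum>m | m dvd n. of_nat m ^ e * of_bool (i * k dvd n div m) :: complex)" if "n > 0"
      using that n by (intro sum.mono_neutral_cong) auto
    with n assms show ?thesis by (simp add: fps_nth_compose_X_power lambert_fps_nth)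
  next
    case False
    have "\<not> i * k dvd n div m" if "m dvd n" for m
      using False that by (metis dvd_div_mult_self dvd_mult2 dvd_mult_right)
    with False assms show ?thesis
      by (auto simp: fps_nth_compose_X_power lambert_fps_nth intro!: sum.neutral[symmetric])
  qed
qed

context
  fixes s q :: "nat \<Rightarrow> complex fps"
  defines "s \<equiv> div_sum 1" and "q \<equiv> div_sum 3"
begin

text \<open>\<theta> applied to a series in \<open>fps_X ^ i\<close> produces a factor
  \<open>i\<close>; the relation is multiplied by \<open>i\<close> to absorb it.\<close>

lemma div_sum_convolution_1_dilated:
  assumes "i > 0"
  shows "12 * of_nat i * (s i * s i) = 5 * of_nat i * q i + of_nat i * s i - 6 * theta (s i)"
proof -
  have "(12 * (s 1 * s 1)) oo fps_X ^ i = (5 * q 1 + s 1 - 6 * theta (s 1)) oo fps_X ^ i"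
    using div_sum_convolution_1 by (simp only: s_def q_def)
  then have "12 * (s i * s i) = 5 * q i + s i - 6 * (theta (s 1) oo fps_X ^ i)"
    using assms by (simp add: s_def q_def fps_compose_mult_distrib fps_compose_add_distrib
       fps_compose_sub_distrib div_sum_compose[of i _ 1, simplified])
  then have "of_nat i * (12 * (s i * s i)) = of_nat i * (5 * q i + s i - 6 * (theta (s 1) oo fps_X ^ i))"
    by simp
  moreover have "theta (s i) = of_nat i * (theta (s 1) oo fps_X ^ i)"
    using theta_compose_X_power[OF assms, of "s 1"] assms by (simp add: s_def div_sum_compose[of i _ 1, simplified])
  ultimately show ?thesis by (simp add: algebra_simps)
qed

lemma div_sum_convolution_2_dilated:
  "36 * (s 3 * s 3) - 144 * (s 3 * s 6) + 72 * (s 6 * s 6) = 6 * theta (s 6) - 18 * q 6 + 3 * q 3 - 3 * s 3"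
proof -
  have "(12 * (s 1 * s 1) - 48 * (s 1 * s 2) + 24 * (s 2 * s 2)) oo fps_X ^ 3 =
      (6 * theta (s 2) - 6 * q 2 + q 1 - s 1) oo fps_X ^ 3"
    using div_sum_convolution_2 by (simp only: s_def q_def)
  then have "12 * (s 3 * s 3) - 48 * (s 3 * s 6) + 24 * (s 6 * s 6) =
      6 * (theta (s 2) oo fps_X ^ 3) - 6 * q 6 + q 3 - s 3"
    by (simp add: s_def q_def fps_compose_mult_distrib fps_compose_add_distrib
       fps_compose_sub_distrib div_sum_compose[of 3 _ 1, simplified] div_sum_compose)
  moreover have "theta (s 6) = 3 * (theta (s 2) oo fps_X ^ 3)"
    using theta_compose_X_power[of 3 "s 2"] by (simp add: s_def div_sum_compose)
  ultimately show ?thesis by algebra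
qed

lemma div_sum_convolution_3_dilated:
  "12 * (s 2 * s 2) - 72 * (s 2 * s 6) + 36 * (s 6 * s 6) = 6 * theta (s 6) - 12 * q 6 + 2 * q 2 - 2 * s 2"
proof -
  have "(6 * (s 1 * s 1) - 36 * (s 1 * s 3) + 18 * (s 3 * s 3)) oo fps_X ^ 2 =
      (6 * theta (s 3) - 6 * q 3 + q 1 - s 1) oo fps_X ^ 2"
    using div_sum_convolution_3 by (simp only: s_def q_def)
  then have "6 * (s 2 * s 2) - 36 * (s 2 * s 6) + 18 * (s 6 * s 6) =
      6 * (theta (s 3) oo fps_X ^ 2) - 6 * q 6 + q 2 - s 2"
    by (simp add: s_def q_def fps_compose_mult_distrib fps_compose_add_distrib
       fps_compose_sub_distrib div_sum_compose[of 2 _ 1, simplified] div_sum_compose)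
  moreover have "theta (s 6) = 2 * (theta (s 3) oo fps_X ^ 2)"
    using theta_compose_X_power[of 2 "s 3"] by (simp add: s_def div_sum_compose)
  ultimately show ?thesis by algebra
qed

text \<open>Here \<open>z\<close> and \<open>b\<close> are the linear combinations to be identified
  with the eta quotients z and y z. The first two relations say that they have the right logarithmic
  derivatives \<open>M\<close> and \<open>M + W\<close>; the other two yield the differential
  equation.\<close>

lemma level_6_relations:
  defines "z \<equiv> 1 - 4 * s 1 + 16 * s 2 + 12 * s 3 - 48 * s 6"
    and "b \<equiv> s 1 - s 2 - 3 * s 3 + 3 * s 6"
    and "W \<equiv> 1 + 6 * s 1 - 12 * s 2 + 18 * s 3 - 36 * s 6"
    and "M \<equiv> 4 * s 2 + 12 * s 6 - 4 * s 1 - 12 * s 3"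
  shows "theta z = z * M"
    and "theta b = b * (M + W)"
    and "W\<^sup>2 = (z + 4 * b) * (z + 16 * b)"
    and "2 * theta M = M\<^sup>2 - 8 * b * z - 64 * b\<^sup>2"
proof -
  \<comment> \<open>Each \<open>r\<close> is a convolution relation moved to one side: the first
    digit is its level, the second its dilation.\<close>
  define r11 where "r11 = 12 * (s 1 * s 1) - (5 * q 1 + s 1 - 6 * theta (s 1))"
  define r12 where "r12 = 24 * (s 2 * s 2) - (10 * q 2 + 2 * s 2 - 6 * theta (s 2))"
  define r13 where "r13 = 36 * (s 3 * s 3) - (15 * q 3 + 3 * s 3 - 6 * theta (s 3))"
  define r16 where "r16 = 72 * (s 6 * s 6) - (30 * q 6 + 6 * s 6 - 6 * theta (s 6))"
  define r21 where "r21 = 12 * (s 1 * s 1) - 48 * (s 1 * s 2) + 24 * (s 2 * s 2)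
     - (6 * theta (s 2) - 6 * q 2 + q 1 - s 1)"
  define r23 where "r23 = 36 * (s 3 * s 3) - 144 * (s 3 * s 6) + 72 * (s 6 * s 6)
     - (6 * theta (s 6) - 18 * q 6 + 3 * q 3 - 3 * s 3)"
  define r31 where "r31 = 6 * (s 1 * s 1) - 36 * (s 1 * s 3) + 18 * (s 3 * s 3)
     - (6 * theta (s 3) - 6 * q 3 + q 1 - s 1)"
  define r32 where "r32 = 12 * (s 2 * s 2) - 72 * (s 2 * s 6) + 36 * (s 6 * s 6)
     - (6 * theta (s 6) - 12 * q 6 + 2 * q 2 - 2 * s 2)"
  define r61 where "r61 = 6 * (s 1 * s 1) - 12 * (s 1 * s 3) + 18 * (s 3 * s 3) - 12 * (s 1 * s 2)
     - 12 * (s 1 * s 6) + 12 * (s 2 * s 3) - 36 * (s 3 * s 6) + 12 * (s 2 * s 2) - 24 * (s 2 * s 6)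
     + 36 * (s 6 * s 6) - (6 * theta (s 6) - 6 * q 6 + q 1 - s 1)"
  note r_def = r11_def r12_def r13_def r16_def r21_def r23_def r31_def r32_def r61_def
  have r0: "r11 = 0" "r12 = 0" "r13 = 0" "r16 = 0" "r21 = 0" "r23 = 0" "r31 = 0" "r32 = 0" "r61 = 0"
    using div_sum_convolution_1_dilated[of 1] div_sum_convolution_1_dilated[of 2] div_sum_convolution_1_dilated[of 3]
      div_sum_convolution_1_dilated[of 6] div_sum_convolution_2 div_sum_convolution_2_dilated
      div_sum_convolution_3 div_sum_convolution_3_dilated div_sum_convolution_6
    unfolding r_def by (simp_all only: s_def q_def right_minus_eq) simp_all
  txt \<open>The coefficients below solve the linear system that eliminates the cubic divisor sums \<open>q i\<close>.\<close>
  have "3 * (theta z - z * M) = - 2 * r11 - 6 * r12 - 6 * r13 + 6 * r16 - 14 * r21 + 6 * r23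
     - 12 * r31 - 12 * r32 + 36 * r61"
    unfolding r_def z_def M_def by (simp add: algebra_simps)
  then show "theta z = z * M" unfolding r0 by simp
  have "6 * (theta b - b * (M + W)) = r11 + 3 * r16 + r21 + 6 * r23 + 3 * r31 + 3 * r32 - 9 * r61"
    unfolding r_def b_def M_def W_def by (simp add: algebra_simps)
  then show "theta b = b * (M + W)" unfolding r0 by simp
  have "W\<^sup>2 - (z + 4 * b) * (z + 16 * b) = 6 * r12 - 6 * r13 + 6 * r16 + 6 * r21 + 18 * r23 - 6 * r31 - 12 * r32"
    unfolding r_def b_def z_def W_def by (simp add: algebra_simps power2_eq_square)
  then show "W\<^sup>2 = (z + 4 * b) * (z + 16 * b)" unfolding r0 by simp
  have "3 * (2 * theta M - (M\<^sup>2 - 8 * b * z - 64 * b\<^sup>2)) =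
      - 4 * r11 + 12 * r13 - 12 * r16 - 4 * r21 - 12 * r23 + 24 * r31 - 12 * r32"
    unfolding r_def b_def z_def M_def by (simp add: algebra_simps power2_eq_square)
  then have "3 * (2 * theta M - (M\<^sup>2 - 8 * b * z - 64 * b\<^sup>2)) = 0" unfolding r0 by simp
  then show "2 * theta M = M\<^sup>2 - 8 * b * z - 64 * b\<^sup>2"
    by (simp only: mult_eq_0_iff numeral_neq_fps_zero simp_thms right_minus_eq)
qed

end

section \<open>Uniqueness of power series solutions of equations in \<theta>\<close>

lemma fps_mult_nth_lowest:
  assumes "\<And>k. k < n \<Longrightarrow> f $ k = 0"
  shows "(g * f) $ n = g $ 0 * (f $ n :: complex)"
proof -
  have "(g * f) $ n = (\<Sum>i\<in>{0..n}. g $ i * f $ (n - i))" by (simp add: fps_mult_nth)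
  also have "\<dots> = (\<Sum>i\<in>{0}. g $ i * f $ (n - i))"
    using assms by (intro sum.mono_neutral_right) auto
  finally show ?thesis by simp
qed

text \<open>Comparing lowest nonzero coefficients, at index \<open>n\<close> say, forces
  \<open>n = g $ 0\<close>, hence \<open>n = m\<close>, where the coefficient vanishes by
  assumption.\<close>

lemma theta_log_deriv_eq_0:
  assumes "theta f = f * g" "g $ 0 = of_nat m" "f $ m = 0"
  shows "f = 0"
proof -
  have "f $ n = 0" for n
  proof (induction n rule: less_induct)
    case (less n)
    have "of_nat n * f $ n = (g * f) $ n"
      using arg_cong[OF assms(1), of "\<lambda>h. h $ n"] by (simp add: mult.commute)
    also have "\<dots> = of_nat m * f $ n" using less assms(2) by (simp add: fps_mult_nth_lowest)
    finally show ?case using assms(3) by auto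
  qed
  then show ?thesis by (simp add: fps_ext)
qed

lemma theta_log_deriv_unique:
  assumes "theta f = f * g" "theta h = h * g" "g $ 0 = of_nat m" "f $ m = h $ m"
  shows "f = h"
  using theta_log_deriv_eq_0[of "f - h" g m] assms by (simp add: algebra_simps)

text \<open>Induction on the index: once all lower coefficients vanish, only \<open>a3\<close> has a
  constant term, so the linear relation kills the coefficient of \<open>e3\<close>, and the chain of
  derivatives then kills the others. At index 0 the chain gives \<open>e1\<close> and
  \<open>e2\<close>, and \<open>e0\<close> is covered by assumption.\<close>

lemma third_order_system_unique:
  fixes e0 e1 e2 e3 r a0 a1 a2 a3 :: "complex fps"
  assumes "e0 $ 0 = 0" "r $ 0 \<noteq> 0" "a3 $ 0 \<noteq> 0" "a2 $ 0 = 0" "a1 $ 0 = 0" "a0 $ 0 = 0"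
    and "theta e0 = r * e1" "theta e1 = r * e2" "theta e2 = r * e3"
    and "a3 * e3 + a2 * e2 + a1 * e1 + a0 * e0 = 0"
  shows "e0 = 0"
proof -
  have "e0 $ n = 0 \<and> e1 $ n = 0 \<and> e2 $ n = 0 \<and> e3 $ n = 0" for n
  proof (induction n rule: less_induct)
    case (less n)
    then have low: "(g * e0) $ n = g $ 0 * e0 $ n" "(g * e1) $ n = g $ 0 * e1 $ n"
      "(g * e2) $ n = g $ 0 * e2 $ n" "(g * e3) $ n = g $ 0 * e3 $ n" for g
      by (simp_all add: fps_mult_nth_lowest)
    have e3: "e3 $ n = 0"
      using arg_cong[OF assms(10), of "\<lambda>h. h $ n"] assms(3-6) by (simp add: low)
    have eqs: "of_nat n * e0 $ n = r $ 0 * e1 $ n" "of_nat n * e1 $ n = r $ 0 * e2 $ n"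
       "of_nat n * e2 $ n = r $ 0 * e3 $ n"
      using arg_cong[OF assms(7), of "\<lambda>h. h $ n"] arg_cong[OF assms(8), of "\<lambda>h. h $ n"]
        arg_cong[OF assms(9), of "\<lambda>h. h $ n"] by (simp_all add: low)
    show ?case
    proof (cases "n = 0")
      case True
      then show ?thesis using eqs e3 assms(1,2) by simp
    next
      case False
      then show ?thesis using eqs e3 by simp
    qed
  qed
  then show ?thesis by (simp add: fps_ext)
qed

text \<open>With \<open>'\<close> for \<open>v d/dv\<close>, the hypotheses on \<open>Y\<close> say
  \<open>Y (\<rho>' Y' + 2 \<rho> Y'') = \<rho> Y'\<^sup>2 - 2 \<kappa> Y\<^sup>2\<close>, and the derivative of this relation is \<open>Y\<close> times the
  linear equation assumed of \<open>f\<close>.\<close>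

theorem weight_2_composition:
  fixes v r Y M f \<rho> \<kappa> :: "complex fps"
  assumes v: "v $ 0 = 0" "theta v = v * r" and r0: "r $ 0 \<noteq> 0"
    and r2: "r\<^sup>2 = Y\<^sup>2 * (\<rho> oo v)"
    and Y: "theta Y = Y * M" "Y $ 0 = f $ 0" and f0: "f $ 0 \<noteq> 0"
    and M: "2 * theta M = M\<^sup>2 - 2 * Y\<^sup>2 * (\<kappa> oo v)"
    and \<rho>0: "\<rho> $ 0 \<noteq> 0" and \<kappa>0: "\<kappa> $ 0 = 0"
    and f: "2 * \<rho> * theta (theta (theta f)) + 3 * theta \<rho> * theta (theta f)
        + (theta (theta \<rho>) + 4 * \<kappa>) * theta f + 2 * theta \<kappa> * f = 0"
  shows "Y = f oo v"
proof -
  define R0 R1 R2 K0 K1 where R_def: "R0 = \<rho> oo v" "R1 = theta \<rho> oo v" "R2 = theta (theta \<rho>) oo v"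
    "K0 = \<kappa> oo v" "K1 = theta \<kappa> oo v"
  have dR: "theta R0 = R1 * r" "theta R1 = R2 * r" "theta K0 = K1 * r"
    unfolding R_def by (simp_all add: theta_compose[OF v])
  \<comment> \<open>Dividing \<theta> by \<open>r\<close> gives the Euler operator in
    \<open>v\<close>, so these are its first three iterates on \<open>Y\<close>.\<close>
  define y1 where "y1 = theta Y * inverse r"
  define y2 where "y2 = theta y1 * inverse r"
  define y3 where "y3 = theta y2 * inverse r"
  have inv: "inverse r * r = 1" using r0 by (rule inverse_mult_eq_1)
  have y: "theta Y = r * y1" "theta y1 = r * y2" "theta y2 = r * y3"
    unfolding y1_def y2_def y3_def using inv by algebra+
  have nz: "Y \<noteq> 0" "r \<noteq> 0" using Y(2) f0 r0 by auto
  have YM: "Y * M = r * y1" using y(1) Y(1) by simp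
  have r2': "r\<^sup>2 = Y\<^sup>2 * R0" using r2 by (simp add: R_def)
  have M': "2 * theta M = M\<^sup>2 - 2 * Y\<^sup>2 * K0" using M by (simp add: R_def)
  have "r * (2 * theta r) = r * (2 * Y * y1 * R0 + Y\<^sup>2 * R1)"
    using arg_cong[OF r2', of theta] by (simp add: theta_power2 theta_mult dR y) algebra
  then have dr: "2 * theta r = 2 * Y * y1 * R0 + Y\<^sup>2 * R1" using nz by simp
  have "Y\<^sup>2 * M\<^sup>2 = Y\<^sup>2 * (R0 * y1\<^sup>2)" using YM r2' by algebra
  then have M2: "M\<^sup>2 = R0 * y1\<^sup>2" using nz by simp
  have dYM: "theta Y * M + Y * theta M = theta r * y1 + r * (r * y2)"
    using arg_cong[OF YM, of theta] by (simp add: theta_mult y)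
  \<comment> \<open>Eliminating \<open>M\<close> and \<open>r\<close> from the derivative of
    \<open>Y * M = r * y1\<close> leaves \<open>Y\<close> times the quadratic equation.\<close>
  have "Y * (Y * (R1 * y1 + 2 * R0 * y2)) = Y * (R0 * y1\<^sup>2 - 2 * Y\<^sup>2 * K0)"
    using dYM dr M2 M' r2' Y(1) by algebra
  then have N: "Y * (R1 * y1 + 2 * R0 * y2) = R0 * y1\<^sup>2 - 2 * Y\<^sup>2 * K0" using nz by simp
  have "r * (Y * (2 * R0 * y3 + 3 * R1 * y2 + (R2 + 4 * K0) * y1 + 2 * K1 * Y)) = 0"
    using arg_cong[OF N, of theta] by (simp add: theta_power2 theta_mult dR y) algebra
  then have L: "2 * R0 * y3 + 3 * R1 * y2 + (R2 + 4 * K0) * y1 + 2 * K1 * Y = 0" using nz by simp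
  define g0 g1 g2 g3 where g_def: "g0 = f oo v" "g1 = theta f oo v" "g2 = theta (theta f) oo v"
    "g3 = theta (theta (theta f)) oo v"
  have dg: "theta g0 = r * g1" "theta g1 = r * g2" "theta g2 = r * g3"
    unfolding g_def by (simp_all add: theta_compose[OF v])
  have G: "2 * R0 * g3 + 3 * R1 * g2 + (R2 + 4 * K0) * g1 + 2 * K1 * g0 = 0"
    using arg_cong[OF f, of "\<lambda>h. h oo v"] v(1)
    by (simp add: R_def g_def fps_compose_mult_distrib fps_compose_add_distrib)
  have g00: "g0 $ 0 = f $ 0" by (simp add: g_def)
  \<comment> \<open>Both series solve the same linear equation and agree at 0. Its lower
    coefficients have no constant term, being Euler derivatives or multiples of \<kappa>.\<close>
  have "Y - g0 = 0"
  proof (rule third_order_system_unique[where r = r and ?e1.0 = "y1 - g1" and ?e2.0 = "y2 - g2" and ?e3.0 = "y3 - g3"])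
    show "2 * R0 * (y3 - g3) + 3 * R1 * (y2 - g2) + (R2 + 4 * K0) * (y1 - g1) + 2 * K1 * (Y - g0) = 0"
      using L G by algebra
  qed (use r0 \<rho>0 \<kappa>0 Y(2) g00 in \<open>simp_all add: y dg R_def right_diff_distrib\<close>)
  then show ?thesis by (simp add: g_def)
qed

section \<open>The eta quotients as formal power series\<close>

text \<open>The formal logarithm of the product of all 1 - q^j. Its constant term is 0 divided by 0,
  which is 0.\<close>

definition log_euler :: "complex fps" where
  "log_euler = Abs_fps (\<lambda>n. - (div_sum 1 1 $ n) / of_nat n)"

lemma theta_log_euler: "theta log_euler = - div_sum 1 1"
  by (rule fps_ext) (simp add: log_euler_def lambert_fps_nth)

lemma theta_log_euler_compose:
  assumes "k > 0"
  shows "theta (log_euler oo fps_X ^ k) = - (of_nat k * div_sum 1 k)"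
  using assms theta_compose_X_power[OF assms, of log_euler]
  by (simp add: theta_log_euler fps_compose_uminus div_sum_compose[of k _ 1, simplified])

lemma theta_exp_compose:
  assumes "L $ 0 = 0"
  shows "theta (fps_exp 1 oo L) = (fps_exp 1 oo L) * theta L"
  using assms by (simp add: theta_def fps_compose_deriv algebra_simps)

text \<open>The multipliers are the exponents of the Euler products in z;
  \<open>mod_z_expansion\<close> identifies this series with the Taylor series of
  \<open>mod_z\<close>.\<close>

definition z_fps :: "complex fps" where
  "z_fps = fps_exp 1 oo (4 * (log_euler oo fps_X ^ 1) + 4 * (log_euler oo fps_X ^ 3)
     - 2 * (log_euler oo fps_X ^ 2) - 2 * (log_euler oo fps_X ^ 6))"

definition y_fps :: "complex fps" where
  "y_fps = fps_X * (fps_exp 1 oo (6 * (log_euler oo fps_X ^ 2) + 6 * (log_euler oo fps_X ^ 6)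
     - 6 * (log_euler oo fps_X ^ 1) - 6 * (log_euler oo fps_X ^ 3)))"

definition W_fps :: "complex fps" where
  "W_fps = 1 + 6 * div_sum 1 1 - 12 * div_sum 1 2 + 18 * div_sum 1 3 - 36 * div_sum 1 6"

definition M_fps :: "complex fps" where
  "M_fps = 4 * div_sum 1 2 + 12 * div_sum 1 6 - 4 * div_sum 1 1 - 12 * div_sum 1 3"

lemma log_euler_0 [simp]: "log_euler $ 0 = 0"
  by (simp add: log_euler_def)

lemma theta_z_fps: "theta z_fps = z_fps * M_fps"
  unfolding z_fps_def
  by (subst theta_exp_compose) (simp_all add: theta_log_euler_compose theta_log_euler M_fps_def)

lemma theta_y_fps: "theta y_fps = y_fps * W_fps"
  unfolding y_fps_def
  by (subst theta_mult, subst theta_exp_compose)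
     (simp_all add: theta_X theta_log_euler_compose theta_log_euler W_fps_def algebra_simps)

lemma z_fps_0 [simp]: "z_fps $ 0 = 1" and y_fps_0 [simp]: "y_fps $ 0 = 0"
  by (simp_all add: z_fps_def y_fps_def)

lemma lambert_fps_nth_0 [simp]: "lambert_fps e I $ 0 = 0"
  by (simp add: lambert_fps_nth)

text \<open>Both sides have logarithmic derivative \<open>M_fps\<close>, whose constant term is 0,
  so it suffices to compare constant terms.\<close>

lemma z_fps_eq:
  "z_fps = 1 - 4 * div_sum 1 1 + 16 * div_sum 1 2 + 12 * div_sum 1 3 - 48 * div_sum 1 6"
proof (rule theta_log_deriv_unique)
  show "M_fps $ 0 = of_nat 0" by (simp add: M_fps_def)
qed (use level_6_relations(1) theta_z_fps in \<open>simp_all add: M_fps_def\<close>)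

text \<open>As before, but the logarithmic derivative now has constant term 1, so the coefficients
  of q are compared.\<close>

lemma y_z_fps_eq:
  "y_fps * z_fps = div_sum 1 1 - div_sum 1 2 - 3 * div_sum 1 3 + 3 * div_sum 1 6"
proof (rule theta_log_deriv_unique)
  show "theta (y_fps * z_fps) = (y_fps * z_fps) * (M_fps + W_fps)"
    by (simp add: theta_mult theta_y_fps theta_z_fps algebra_simps)
  show "(M_fps + W_fps) $ 0 = of_nat 1" by (simp add: M_fps_def W_fps_def)
  show "(y_fps * z_fps) $ 1 = (div_sum 1 1 - div_sum 1 2 - 3 * div_sum 1 3 + 3 * div_sum 1 6) $ 1"
    by (simp add: fps_mult_nth_1 lambert_fps_nth y_fps_def fps_mult_fps_X_nonzero)
qed (use level_6_relations(2) in \<open>simp_all add: M_fps_def W_fps_def\<close>)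

lemma W_fps_squared: "W_fps\<^sup>2 = z_fps\<^sup>2 * (1 + 4 * y_fps) * (1 + 16 * y_fps)"
proof -
  have "W_fps\<^sup>2 = (z_fps + 4 * (y_fps * z_fps)) * (z_fps + 16 * (y_fps * z_fps))"
    using level_6_relations(3) unfolding y_z_fps_eq by (simp only: z_fps_eq W_fps_def)
  then show ?thesis by algebra
qed

lemma theta_M_fps: "2 * theta M_fps = M_fps\<^sup>2 - 8 * z_fps\<^sup>2 * y_fps * (1 + 8 * y_fps)"
proof -
  have "2 * theta M_fps = M_fps\<^sup>2 - 8 * (y_fps * z_fps) * z_fps - 64 * (y_fps * z_fps)\<^sup>2"
    using level_6_relations(4) unfolding y_z_fps_eq by (simp only: z_fps_eq M_fps_def)
  then show ?thesis by algebra
qed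

lemma W_fps_0 [simp]: "W_fps $ 0 = 1"
  by (simp add: W_fps_def)

text \<open>\<theta> is applied to the formula for the square of \<open>W_fps\<close>, and
  \<open>W_fps\<close> is cancelled. The polynomial 20 y + 128 y^2 is the Euler derivative of (1 + 4
  y) (1 + 16 y).\<close>

lemma theta_W_fps: "2 * theta W_fps = 2 * W_fps * M_fps + z_fps\<^sup>2 * (20 * y_fps + 128 * y_fps\<^sup>2)"
proof -
  have "2 * W_fps * theta W_fps = theta (z_fps\<^sup>2 * (1 + 4 * y_fps) * (1 + 16 * y_fps))"
    by (simp only: W_fps_squared[symmetric] theta_power2)
  also have "\<dots> = 2 * M_fps * (z_fps\<^sup>2 * (1 + 4 * y_fps) * (1 + 16 * y_fps)) + z_fps\<^sup>2 * W_fps * (20 * y_fps + 128 * y_fps\<^sup>2)"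
    by (simp add: theta_power2 theta_mult theta_y_fps theta_z_fps power2_eq_square algebra_simps)
  finally have "W_fps * (2 * theta W_fps) = W_fps * (2 * W_fps * M_fps + z_fps\<^sup>2 * (20 * y_fps + 128 * y_fps\<^sup>2))"
    unfolding W_fps_squared[symmetric] by (simp add: power2_eq_square algebra_simps)
  moreover have "W_fps \<noteq> 0" using W_fps_0 by (metis fps_zero_nth zero_neq_one)
  ultimately show ?thesis by simp
qed

section \<open>Change of variables from y, z to x, Z\<close>

definition x_fps :: "complex fps" where "x_fps = y_fps * inverse (1 + 4 * y_fps)"
definition Z_fps :: "complex fps" where "Z_fps = (1 + 4 * y_fps) * z_fps"

text \<open>The undilated series and the one dilated by 3 cancel in z + 4 y z; what remains is the
  formal version of (3 P(q^6) - P(q^2)) / 2.\<close>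

lemma Z_fps_eq: "Z_fps = 1 + 12 * div_sum 1 2 - 36 * div_sum 1 6"
proof -
  have "Z_fps = z_fps + 4 * (y_fps * z_fps)" by (simp add: Z_fps_def algebra_simps)
  then show ?thesis unfolding y_z_fps_eq by (simp add: z_fps_eq algebra_simps)
qed

lemma x_fps_0 [simp]: "x_fps $ 0 = 0" and Z_fps_0 [simp]: "Z_fps $ 0 = 1"
  by (simp_all add: x_fps_def Z_fps_def)

lemma y_fps_conv_x: "(1 + 4 * y_fps) * (1 - 4 * x_fps) = 1"
  and x_fps_mult: "x_fps * (1 + 4 * y_fps) = y_fps"
proof -
  have "inverse (1 + 4 * y_fps) * (1 + 4 * y_fps) = 1" by (rule inverse_mult_eq_1) simp
  then show "x_fps * (1 + 4 * y_fps) = y_fps" "(1 + 4 * y_fps) * (1 - 4 * x_fps) = 1"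
    unfolding x_fps_def by algebra+
qed

lemma theta_x_fps: "theta x_fps = x_fps * (W_fps * (1 - 4 * x_fps))"
proof -
  have "theta x_fps * (1 + 4 * y_fps) + 4 * x_fps * y_fps * W_fps = y_fps * W_fps"
    using arg_cong[OF x_fps_mult, of theta] by (simp add: theta_mult theta_y_fps algebra_simps)
  then have "(1 + 4 * y_fps) * theta x_fps = y_fps * (W_fps * (1 - 4 * x_fps))"
    by (simp add: algebra_simps)
  also have "\<dots> = x_fps * (1 + 4 * y_fps) * (W_fps * (1 - 4 * x_fps))" by (simp only: x_fps_mult)
  finally have "(1 + 4 * y_fps) * theta x_fps = (1 + 4 * y_fps) * (x_fps * (W_fps * (1 - 4 * x_fps)))"
    by (simp only: mult_ac)
  moreover have "1 + 4 * y_fps \<noteq> 0" using y_fps_conv_x by auto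
  ultimately show ?thesis by simp
qed

lemma theta_Z_fps: "theta Z_fps = Z_fps * (M_fps + 4 * x_fps * W_fps)"
proof -
  have "theta Z_fps = 4 * (y_fps * W_fps) * z_fps + (1 + 4 * y_fps) * (z_fps * M_fps)"
    by (simp add: Z_fps_def theta_mult theta_y_fps theta_z_fps)
  also have "\<dots> = 4 * (x_fps * (1 + 4 * y_fps) * W_fps) * z_fps + (1 + 4 * y_fps) * (z_fps * M_fps)"
    by (simp only: x_fps_mult)
  finally show ?thesis unfolding Z_fps_def by (simp add: algebra_simps)
qed

lemma W_fps_squared_x: "W_fps\<^sup>2 = Z_fps\<^sup>2 * (1 + 12 * x_fps)"
proof -
  have "Z_fps\<^sup>2 * (1 + 12 * x_fps) = z_fps\<^sup>2 * (1 + 4 * y_fps) * (1 + 4 * y_fps + 12 * (x_fps * (1 + 4 * y_fps)))"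
    unfolding Z_fps_def by algebra
  also have "\<dots> = W_fps\<^sup>2"
    unfolding x_fps_mult W_fps_squared by (simp add: algebra_simps)
  finally show ?thesis by (rule sym)
qed

text \<open>The analogue of \<open>theta_M_fps\<close> for Z, whose logarithmic derivative is
  \<open>M_fps + 4 * x_fps * W_fps\<close>.\<close>

lemma theta_M_fps_x:
  "2 * theta (M_fps + 4 * x_fps * W_fps) =
     (M_fps + 4 * x_fps * W_fps)\<^sup>2 + 96 * Z_fps\<^sup>2 * x_fps\<^sup>2 * (1 - 4 * x_fps)"
proof -
  have "Z_fps * (1 - 4 * x_fps) = z_fps * ((1 + 4 * y_fps) * (1 - 4 * x_fps))"
    unfolding Z_fps_def by (simp only: mult_ac)
  then have z: "z_fps = Z_fps * (1 - 4 * x_fps)" unfolding y_fps_conv_x by simp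
  have yz: "y_fps * z_fps = x_fps * Z_fps" unfolding Z_fps_def mult.assoc[symmetric] x_fps_mult ..
  have "2 * theta M_fps = M_fps\<^sup>2 - 8 * (y_fps * z_fps) * z_fps - 64 * (y_fps * z_fps)\<^sup>2"
    using theta_M_fps by algebra
  then have M: "2 * theta M_fps = M_fps\<^sup>2 - 8 * (x_fps * Z_fps) * (Z_fps * (1 - 4 * x_fps)) - 64 * (x_fps * Z_fps)\<^sup>2"
    unfolding yz unfolding z .
  have "2 * theta W_fps = 2 * W_fps * M_fps + 20 * (y_fps * z_fps) * z_fps + 128 * (y_fps * z_fps)\<^sup>2"
    using theta_W_fps by algebra
  then have W: "2 * theta W_fps = 2 * W_fps * M_fps + 20 * (x_fps * Z_fps) * (Z_fps * (1 - 4 * x_fps)) + 128 * (x_fps * Z_fps)\<^sup>2"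
    unfolding yz unfolding z .
  have "2 * theta (M_fps + 4 * x_fps * W_fps) =
     2 * theta M_fps + 8 * theta x_fps * W_fps + 4 * x_fps * (2 * theta W_fps)"
    by (simp add: theta_mult algebra_simps)
  \<comment> \<open>The last summand is a multiple of the relation \<open>W_fps_squared_x\<close>
    and therefore zero.\<close>
  also have "\<dots> = (M_fps + 4 * x_fps * W_fps)\<^sup>2 + 96 * Z_fps\<^sup>2 * x_fps\<^sup>2 * (1 - 4 * x_fps)
     + (8 * x_fps - 48 * x_fps\<^sup>2) * (W_fps\<^sup>2 - Z_fps\<^sup>2 * (1 + 12 * x_fps))"
    unfolding M W theta_x_fps by algebra
  finally show ?thesis unfolding W_fps_squared_x by simp
qed

section \<open>The linear differential equations in x, in x^2 (1 - 4 x) and in y\<close>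

lemma Z_fps_conv_t:
  assumes "f $ 0 = 1"
    and f: "theta (theta (theta f)) + fps_X * (4 * theta (theta (theta f)) + 6 * theta (theta f) + 2 * theta f)
       - fps_X\<^sup>2 * (80 * theta (theta (theta f)) + 240 * theta (theta f) + 256 * theta f + 96 * f)
       + fps_X ^ 3 * (192 * theta (theta (theta f)) + 864 * theta (theta f) + 1248 * theta f + 576 * f) = 0"
  shows "Z_fps = f oo x_fps"
proof -
  \<comment> \<open>\<rho> combines the square of the factor 1 - 4 x in \<theta> x / x with 1 + 12 x
    from \<open>W_fps_squared_x\<close>; \<kappa> is read off \<open>theta_M_fps_x\<close>.\<close>
  let ?\<rho> = "(1 - 4 * (fps_X :: complex fps))\<^sup>2 * (1 + 12 * fps_X)" and ?\<kappa> = "- 48 * (fps_X :: complex fps)\<^sup>2 * (1 - 4 * fps_X)"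
  show ?thesis
  proof (rule weight_2_composition[where v = "x_fps" and r = "W_fps * (1 - 4 * x_fps)" and Y = "Z_fps"
        and M = "M_fps + 4 * x_fps * W_fps" and \<rho> = ?\<rho> and \<kappa> = ?\<kappa> and f = f])
  show "theta x_fps = x_fps * (W_fps * (1 - 4 * x_fps))" by (rule theta_x_fps)
  show "theta Z_fps = Z_fps * (M_fps + 4 * x_fps * W_fps)" by (rule theta_Z_fps)
  have "?\<rho> oo x_fps = (1 - 4 * x_fps)\<^sup>2 * (1 + 12 * x_fps)"
    by (simp add: fps_compose_mult_distrib fps_compose_add_distrib fps_compose_sub_distrib
        fps_compose_uminus flip: fps_compose_power)
  then show "(W_fps * (1 - 4 * x_fps))\<^sup>2 = Z_fps\<^sup>2 * (?\<rho> oo x_fps)"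
    using W_fps_squared_x by algebra
  have "?\<kappa> oo x_fps = - 48 * x_fps\<^sup>2 * (1 - 4 * x_fps)"
    by (simp add: fps_compose_mult_distrib fps_compose_add_distrib fps_compose_sub_distrib
        fps_compose_uminus flip: fps_compose_power)
  then show "2 * theta (M_fps + 4 * x_fps * W_fps) =
     (M_fps + 4 * x_fps * W_fps)\<^sup>2 - 2 * Z_fps\<^sup>2 * (?\<kappa> oo x_fps)"
    using theta_M_fps_x by algebra
  have \<rho>: "?\<rho> = 1 + 4 * fps_X - 80 * fps_X\<^sup>2 + 192 * fps_X ^ 3" by algebra
  have X2: "theta (fps_X\<^sup>2) = 2 * fps_X\<^sup>2" by (simp add: theta_mult theta_X power2_eq_square)
  have X3: "theta (fps_X ^ 3) = 3 * fps_X ^ 3"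
    by (simp add: power3_eq_cube theta_mult theta_X)
  have \<kappa>: "?\<kappa> = 192 * fps_X ^ 3 - 48 * fps_X\<^sup>2" by algebra
  have d: "theta ?\<rho> = 4 * fps_X - 160 * fps_X\<^sup>2 + 576 * fps_X ^ 3"
    "theta ?\<kappa> = 576 * fps_X ^ 3 - 96 * fps_X\<^sup>2"
    unfolding \<rho> \<kappa> by (simp_all add: theta_X X2 X3)
  have d2: "theta (theta ?\<rho>) = 4 * fps_X - 320 * fps_X\<^sup>2 + 1728 * fps_X ^ 3"
    unfolding d by (simp_all add: theta_X X2 X3)
  show "2 * ?\<rho> * theta (theta (theta f)) + 3 * theta ?\<rho> * theta (theta f)
        + (theta (theta ?\<rho>) + 4 * ?\<kappa>) * theta f + 2 * theta ?\<kappa> * f = 0"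
    unfolding d2 unfolding d unfolding \<rho> \<kappa> using f by algebra
qed (use assms(1) in simp_all)
qed

lemma Z_fps_conv_hypergeom:
  assumes "f $ 0 = 1"
    and f: "theta (theta (theta f)) = fps_X * (108 * theta (theta (theta f)) + 162 * theta (theta f) + 78 * theta f + 12 * f)"
  shows "Z_fps = f oo (x_fps\<^sup>2 * (1 - 4 * x_fps))"
proof -
  \<comment> \<open>With v = x^2 (1 - 4 x), \<theta> v / v = 2 W (1 - 6 x), and 4 (1 - 6 x)^2 (1 +
    12 x) = 4 - 432 v is a polynomial in v, as is \<kappa> = -48 v.\<close>
  let ?\<rho> = "4 - 432 * fps_X" and ?\<kappa> = "- 48 * fps_X"
  show ?thesis
  proof (rule weight_2_composition[where v = "x_fps\<^sup>2 * (1 - 4 * x_fps)" and r = "2 * W_fps * (1 - 6 * x_fps)" and Y = "Z_fps"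
        and M = "M_fps + 4 * x_fps * W_fps" and \<rho> = ?\<rho> and \<kappa> = ?\<kappa> and f = f])
  show "theta (x_fps\<^sup>2 * (1 - 4 * x_fps)) = x_fps\<^sup>2 * (1 - 4 * x_fps) * (2 * W_fps * (1 - 6 * x_fps))"
    by (simp add: theta_mult theta_power2 theta_x_fps) algebra
  show "theta Z_fps = Z_fps * (M_fps + 4 * x_fps * W_fps)" by (rule theta_Z_fps)
  have "?\<rho> oo (x_fps\<^sup>2 * (1 - 4 * x_fps)) = 4 - 432 * (x_fps\<^sup>2 * (1 - 4 * x_fps))"
    by (simp add: fps_compose_mult_distrib fps_compose_sub_distrib)
  then show "(2 * W_fps * (1 - 6 * x_fps))\<^sup>2 = Z_fps\<^sup>2 * (?\<rho> oo (x_fps\<^sup>2 * (1 - 4 * x_fps)))"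
    using W_fps_squared_x by algebra
  have "?\<kappa> oo (x_fps\<^sup>2 * (1 - 4 * x_fps)) = - 48 * (x_fps\<^sup>2 * (1 - 4 * x_fps))"
    by (simp add: fps_compose_mult_distrib fps_compose_uminus)
  then show "2 * theta (M_fps + 4 * x_fps * W_fps) =
     (M_fps + 4 * x_fps * W_fps)\<^sup>2 - 2 * Z_fps\<^sup>2 * (?\<kappa> oo (x_fps\<^sup>2 * (1 - 4 * x_fps)))"
    using theta_M_fps_x by algebra
  show "2 * ?\<rho> * theta (theta (theta f)) + 3 * theta ?\<rho> * theta (theta f)
        + (theta (theta ?\<rho>) + 4 * ?\<kappa>) * theta f + 2 * theta ?\<kappa> * f = 0"
    using f by (simp add: theta_X) algebra
qed (use assms(1) in simp_all)
qed

lemma z_fps_conv_domb: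
  assumes "f $ 0 = 1"
    and f: "theta (theta (theta f)) + fps_X * (20 * theta (theta (theta f)) + 30 * theta (theta f) + 18 * theta f + 4 * f)
       + fps_X\<^sup>2 * (64 * theta (theta (theta f)) + 192 * theta (theta f) + 192 * theta f + 64 * f) = 0"
  shows "z_fps = f oo y_fps"
proof -
  let ?\<rho> = "(1 + 4 * fps_X) * (1 + 16 * fps_X)" and ?\<kappa> = "4 * fps_X * (1 + 8 * fps_X)"
  show ?thesis
  proof (rule weight_2_composition[where v = "y_fps" and r = "W_fps" and Y = "z_fps"
        and M = "M_fps" and \<rho> = ?\<rho> and \<kappa> = ?\<kappa> and f = f])
  show "theta y_fps = y_fps * W_fps" by (rule theta_y_fps)
  show "theta z_fps = z_fps * M_fps" by (rule theta_z_fps)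
  have "?\<rho> oo y_fps = (1 + 4 * y_fps) * (1 + 16 * y_fps)"
    by (simp add: fps_compose_mult_distrib fps_compose_add_distrib)
  then show "W_fps\<^sup>2 = z_fps\<^sup>2 * (?\<rho> oo y_fps)"
    using W_fps_squared by algebra
  have "?\<kappa> oo y_fps = 4 * y_fps * (1 + 8 * y_fps)"
    by (simp add: fps_compose_mult_distrib fps_compose_add_distrib)
  then show "2 * theta M_fps = M_fps\<^sup>2 - 2 * z_fps\<^sup>2 * (?\<kappa> oo y_fps)"
    using theta_M_fps by algebra
  show "2 * ?\<rho> * theta (theta (theta f)) + 3 * theta ?\<rho> * theta (theta f)
        + (theta (theta ?\<rho>) + 4 * ?\<kappa>) * theta f + 2 * theta ?\<kappa> * f = 0"
    using f by (simp add: theta_X theta_mult) algebra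
qed (use assms(1) in simp_all)
qed

section \<open>The three coefficient sequences\<close>

text \<open>Up to the factor \<open>(n!)\<^sup>2\<close>, the Domb numbers are the coefficients of the square of this series, whose
  short recurrence makes the Domb recurrence a computation with derivations.\<close>

definition bessel_fps :: "complex fps" where
  "bessel_fps = Abs_fps (\<lambda>j. of_nat ((2 * j) choose j) / fact j ^ 2)"

lemma central_binomial_Suc:
  "of_nat (Suc n) * of_nat ((2 * Suc n) choose Suc n) = (2 * (2 * of_nat n + 1) * of_nat ((2 * n) choose n) :: complex)"
proof -
  have c: "of_nat ((2 * k) choose k) = (fact (2 * k) / (fact k * fact k) :: complex)" for k
    by (subst binomial_fact) (auto simp: mult_2)
  have 2: "fact (2 * Suc n) = 2 * (of_nat (Suc n)) * (2 * of_nat n + 1) * (fact (2 * n) :: complex)"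
    by (simp add: eval_nat_numeral algebra_simps)
  have 1: "fact (Suc n) = of_nat (Suc n) * (fact n :: complex)" by simp
  show ?thesis unfolding c 1 2 by (simp del: of_nat_Suc fact_Suc)
qed

lemma theta_bessel_fps:
  "theta (theta (theta bessel_fps)) = fps_X * (4 * theta bessel_fps + 2 * bessel_fps)"
proof (rule fps_ext)
  fix n
  show "theta (theta (theta bessel_fps)) $ n = (fps_X * (4 * theta bessel_fps + 2 * bessel_fps)) $ n"
  proof (cases n)
    case (Suc m)
    have "of_nat (Suc m) ^ 3 * (of_nat ((2 * Suc m) choose Suc m) / fact (Suc m) ^ 2) =
      (of_nat (Suc m) * of_nat ((2 * Suc m) choose Suc m)) / (fact m ^ 2 :: complex)"
      by (simp add: power2_eq_square power3_eq_cube del: of_nat_Suc binomial_Suc_Suc mult_Suc_right)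
    also have "\<dots> = 4 * (of_nat m * (of_nat ((2 * m) choose m) / fact m ^ 2)) + 2 * (of_nat ((2 * m) choose m) / fact m ^ 2)"
      unfolding central_binomial_Suc by (simp add: add_divide_distrib algebra_simps)
    finally show ?thesis unfolding Suc
      by (simp add: bessel_fps_def power3_eq_cube mult.assoc del: of_nat_Suc binomial_Suc_Suc mult_Suc_right fact_Suc)
  qed simp
qed

lemma bessel_fps_squared_nth: "(bessel_fps\<^sup>2) $ n = of_nat (domb n) / fact n ^ 2"
proof -
  have "(bessel_fps\<^sup>2) $ n = (\<Sum>j=0..n. of_nat ((2 * j) choose j) / fact j ^ 2 *
     (of_nat ((2 * (n - j)) choose (n - j)) / fact (n - j) ^ 2))"
    by (simp add: power2_eq_square fps_mult_nth bessel_fps_def)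
  also have "\<dots> = (\<Sum>j=0..n. of_nat ((n choose j)\<^sup>2 * ((2 * j) choose j) * ((2 * n - 2 * j) choose (n - j))) / fact n ^ 2)"
  proof (rule sum.cong)
    fix j assume "j \<in> {0..n}"
    then have "of_nat (n choose j) = (fact n / (fact j * fact (n - j)) :: complex)"
      by (simp add: binomial_fact)
    then show "of_nat ((2 * j) choose j) / fact j ^ 2 *
     (of_nat ((2 * (n - j)) choose (n - j)) / fact (n - j) ^ 2) =
     (of_nat ((n choose j)\<^sup>2 * ((2 * j) choose j) * ((2 * n - 2 * j) choose (n - j))) / fact n ^ 2 :: complex)"
      by (simp add: diff_mult_distrib2 power_divide power_mult_distrib)
  qed simp
  finally show ?thesis by (simp add: domb_def sum_divide_distrib)
qed

text \<open>By \<open>theta_bessel_fps\<close>, all \<theta>-derivatives of \<open>V\<close> reduce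
  to quadratic forms in \<open>A\<close>, \<open>A1\<close>, \<open>A2\<close> with coefficients
  polynomial in \<open>fps_X\<close>, where the relation can be checked by expansion.\<close>

lemma theta_bessel_fps_squared:
  defines "V \<equiv> bessel_fps\<^sup>2"
  shows "theta (theta (theta (theta (theta V)))) + 64 * fps_X\<^sup>2 * (theta V + V) =
     2 * fps_X * (10 * theta (theta (theta V)) + 15 * theta (theta V) + 9 * theta V + 2 * V)"
proof -
  define A where "A = bessel_fps"
  define A1 where "A1 = theta A"
  define A2 where "A2 = theta A1"
  have d: "theta A = A1" "theta A1 = A2" "theta A2 = fps_X * (4 * A1 + 2 * A)"
    using theta_bessel_fps by (simp_all add: A_def A1_def A2_def)
  have V: "V = A * A" by (simp add: V_def A_def power2_eq_square)
  have V1: "theta V = 2 * A * A1" unfolding V by (simp add: theta_mult d)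
  have V2: "theta (theta V) = 2 * A1 * A1 + 2 * A * A2"
    unfolding V1 by (simp add: theta_mult d algebra_simps)
  have V3: "theta (theta (theta V)) = 6 * A1 * A2 + 2 * A * (fps_X * (4 * A1 + 2 * A))"
    unfolding V2 by (simp add: theta_mult d algebra_simps)
  have V4: "theta (theta (theta (theta V))) = 6 * A2 * A2 + 8 * A1 * (fps_X * (4 * A1 + 2 * A))
     + 2 * A * (fps_X * (4 * A1 + 2 * A)) + 2 * A * (fps_X * (4 * A2 + 2 * A1))"
    unfolding V3 by (simp add: theta_mult d theta_X algebra_simps)
  show ?thesis
    unfolding V4 V3 V2 V1 V by (simp add: theta_mult d theta_X algebra_simps power2_eq_square)
qed

lemma domb_recurrence:
  "of_nat (n + 2) ^ 3 * of_nat (domb (n + 2)) =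
    (2 * (2 * of_nat n + 3) * (5 * of_nat n ^ 2 + 15 * of_nat n + 12) * of_nat (domb (n + 1))
     - 64 * of_nat (n + 1) ^ 3 * of_nat (domb n) :: complex)"
proof -
  define N :: complex where "N = of_nat n"
  define F :: complex where "F = fact n"
  have nz: "N + 1 \<noteq> 0" "N + 2 \<noteq> 0" "F \<noteq> 0"
    unfolding N_def F_def using of_nat_neq_0[of n, where ?'a = complex] of_nat_neq_0[of "Suc n", where ?'a = complex]
    by (simp_all add: algebra_simps)
  have f: "fact (n + 1) = (N + 1) * F" "fact (n + 2) = (N + 2) * ((N + 1) * F)"
    by (simp_all add: N_def F_def algebra_simps)
  define u0 u1 u2 :: complex where "u0 = of_nat (domb n)" and "u1 = of_nat (domb (n + 1))" and "u2 = of_nat (domb (n + 2))"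
  have v: "(bessel_fps\<^sup>2) $ n = u0 / F ^ 2" "(bessel_fps\<^sup>2) $ Suc n = u1 / ((N + 1) * F) ^ 2"
    "(bessel_fps\<^sup>2) $ Suc (Suc n) = u2 / ((N + 2) * ((N + 1) * F)) ^ 2"
    using bessel_fps_squared_nth[of n] bessel_fps_squared_nth[of "n + 1"] bessel_fps_squared_nth[of "n + 2"]
    unfolding f by (simp_all add: u0_def u1_def u2_def F_def)
  define v0 v1 v2 where "v0 = (bessel_fps\<^sup>2) $ n" and "v1 = (bessel_fps\<^sup>2) $ Suc n"
    and "v2 = (bessel_fps\<^sup>2) $ Suc (Suc n)"
  have c: "of_nat (Suc n) = N + 1" "of_nat (Suc (Suc n)) = N + 2" by (simp_all add: N_def)
  have X2: "fps_X\<^sup>2 = fps_X * fps_X" by (rule power2_eq_square)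
  have "(N + 2) ^ 5 * v2 + 64 * (N + 1) * v0 =
     2 * (10 * (N + 1) ^ 3 + 15 * (N + 1) ^ 2 + 9 * (N + 1) + 2) * v1"
    using arg_cong[OF theta_bessel_fps_squared, of "\<lambda>h. h $ Suc (Suc n)"]
    unfolding X2 mult.assoc
    by (simp add: c N_def[symmetric] v0_def[symmetric] v1_def[symmetric] v2_def[symmetric] del: of_nat_Suc)
       (simp add: eval_nat_numeral algebra_simps)
  moreover have "u0 = v0 * F ^ 2" "u1 = v1 * ((N + 1) * F) ^ 2" "u2 = v2 * ((N + 2) * ((N + 1) * F)) ^ 2"
    using nz unfolding v0_def v1_def v2_def v by simp_all
  ultimately have "(N + 2) ^ 5 * u2 + 64 * (N + 1) * u0 * ((N + 2) * (N + 1)) ^ 2 =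
     2 * (10 * (N + 1) ^ 3 + 15 * (N + 1) ^ 2 + 9 * (N + 1) + 2) * u1 * (N + 2) ^ 2"
    by algebra
  \<comment> \<open>The cubic factors as (2 N + 3) (5 N^2 + 15 N + 12), and the factorials leave a
    common square to cancel.\<close>
  then have "(N + 2) ^ 2 * ((N + 2) ^ 3 * u2) =
     (N + 2) ^ 2 * (2 * (2 * N + 3) * (5 * N ^ 2 + 15 * N + 12) * u1 - 64 * (N + 1) ^ 3 * u0)"
    by algebra
  then have "(N + 2) ^ 3 * u2 = 2 * (2 * N + 3) * (5 * N ^ 2 + 15 * N + 12) * u1 - 64 * (N + 1) ^ 3 * u0"
    unfolding mult_cancel_left using nz by simp
  then show ?thesis by (simp add: N_def u0_def u1_def u2_def add_ac)
qed

lemma z_fps_eq_domb: "z_fps = Abs_fps (\<lambda>n. (-1) ^ n * of_nat (domb n)) oo y_fps"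
proof (rule z_fps_conv_domb)
  let ?f = "Abs_fps (\<lambda>n. (-1) ^ n * of_nat (domb n)) :: complex fps"
  have d01: "domb 0 = 1" "domb (Suc 0) = 4" by (simp_all add: domb_def)
  show "?f $ 0 = 1" by (simp add: d01)
  show "theta (theta (theta ?f)) + fps_X * (20 * theta (theta (theta ?f)) + 30 * theta (theta ?f) + 18 * theta ?f + 4 * ?f)
       + fps_X\<^sup>2 * (64 * theta (theta (theta ?f)) + 192 * theta (theta ?f) + 192 * theta ?f + 64 * ?f) = 0" (is "?l = 0")
  proof (rule fps_ext)
    fix n
    consider "n = 0" | "n = 1" | m where "n = Suc (Suc m)"
      by (metis One_nat_def not0_implies_Suc)
    then show "?l $ n = 0 $ n"
    proof cases
      case 3
      have X2: "fps_X\<^sup>2 = fps_X * fps_X" by (rule power2_eq_square)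
      have "?l $ n = (-1) ^ m * (of_nat (m + 2) ^ 3 * of_nat (domb (m + 2)) -
        (2 * (2 * of_nat m + 3) * (5 * of_nat m ^ 2 + 15 * of_nat m + 12) * of_nat (domb (m + 1))
         - 64 * of_nat (m + 1) ^ 3 * of_nat (domb m)))"
        unfolding 3 X2 mult.assoc
        by (simp add: power2_eq_square power3_eq_cube) (simp add: algebra_simps)
      then show ?thesis unfolding domb_recurrence by simp
    qed (simp_all add: d01 power2_eq_square mult.assoc)
  qed
qed

lemma Z_fps_eq_hypergeom:
  "Z_fps = Abs_fps (\<lambda>n. of_nat (((3 * n) choose n) * ((2 * n) choose n)\<^sup>2)) oo (x_fps\<^sup>2 * (1 - 4 * x_fps))"
proof (rule Z_fps_conv_hypergeom)
  let ?c = "\<lambda>n. of_nat (((3 * n) choose n) * ((2 * n) choose n)\<^sup>2) :: complex"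
  let ?f = "Abs_fps ?c"
  show "?f $ 0 = 1" by simp
  have c: "?c n = fact (3 * n) * fact (2 * n) / fact n ^ 5" for n
  proof -
    have "of_nat ((3 * n) choose n) = (fact (3 * n) / (fact n * fact (2 * n)) :: complex)"
      by (subst binomial_fact) auto
    moreover have "of_nat ((2 * n) choose n) = (fact (2 * n) / (fact n * fact n) :: complex)"
      by (subst binomial_fact) (auto simp: mult_2)
    ultimately show ?thesis by (simp add: power2_eq_square eval_nat_numeral)
  qed
  \<comment> \<open>Expanding the right-hand cubic gives the coefficients 108, 162, 78, 12 of the
    differential equation.\<close>
  have rec: "of_nat (Suc n) ^ 3 * ?c (Suc n) = 6 * (2 * of_nat n + 1) * (3 * of_nat n + 1) * (3 * of_nat n + 2) * ?c n" for n
  proof -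
    have 3: "fact (3 * Suc n) = 3 * (of_nat (Suc n)) * (3 * of_nat n + 2) * (3 * of_nat n + 1) * (fact (3 * n) :: complex)"
      by (simp add: eval_nat_numeral algebra_simps)
    have 2: "fact (2 * Suc n) = 2 * (of_nat (Suc n)) * (2 * of_nat n + 1) * (fact (2 * n) :: complex)"
      by (simp add: eval_nat_numeral algebra_simps)
    have 1: "fact (Suc n) = of_nat (Suc n) * (fact n :: complex)" by simp
    show ?thesis
      unfolding c 1 2 3 by (simp add: power_mult_distrib eval_nat_numeral del: of_nat_Suc fact_Suc)
  qed
  show "theta (theta (theta ?f)) = fps_X * (108 * theta (theta (theta ?f)) + 162 * theta (theta ?f) + 78 * theta ?f + 12 * ?f)"
    (is "?l = ?r")
  proof (rule fps_ext)
    fix n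
    show "?l $ n = ?r $ n"
    proof (cases n)
      case (Suc m)
      have "?l $ n = of_nat (Suc m) ^ 3 * ?c (Suc m)"
        unfolding Suc by (simp add: power3_eq_cube del: of_nat_Suc binomial_Suc_Suc mult_Suc_right of_nat_mult)
      also have "\<dots> = ?r $ n" unfolding rec unfolding Suc
        by (simp add: del: of_nat_mult) (simp add: algebra_simps del: of_nat_mult)
      finally show ?thesis .
    qed simp
  qed
qed

lemma Z_fps_eq_t:
  assumes t_0: "t 0 = 1"
    and t_rec: "\<And>n. of_nat (n + 1) ^ 3 * t (n + 1) =
        - 2 * of_nat n * of_nat (n + 1) * of_nat (2 * n + 1) * t n
        + 16 * of_nat n * (5 * of_nat n ^ 2 + 1) * t (n - 1)
        - 96 * of_nat n * (of_nat n - 1) * (2 * of_nat n - 1) * t (n - 2)"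
  shows "Z_fps = Abs_fps t oo x_fps"
proof (rule Z_fps_conv_t)
  let ?f = "Abs_fps t"
  show "?f $ 0 = 1" by (simp add: t_0)
  show "theta (theta (theta ?f)) + fps_X * (4 * theta (theta (theta ?f)) + 6 * theta (theta ?f) + 2 * theta ?f)
       - fps_X\<^sup>2 * (80 * theta (theta (theta ?f)) + 240 * theta (theta ?f) + 256 * theta ?f + 96 * ?f)
       + fps_X ^ 3 * (192 * theta (theta (theta ?f)) + 864 * theta (theta ?f) + 1248 * theta ?f + 576 * ?f) = 0"
    (is "?l = 0")
  proof (rule fps_ext)
    fix n
    \<comment> \<open>The small indices are separate because \<open>n - 1\<close> and
      \<open>n - 2\<close> truncate in \<open>t_rec\<close>; the truncated terms carry a factor
      \<open>n\<close> or \<open>n - 1\<close> that vanishes there.\<close>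
    consider "n = 0" | "n = 1" | "n = 2" | m where "n = Suc (Suc (Suc m))"
      by (metis One_nat_def not0_implies_Suc numeral_2_eq_2)
    then show "?l $ n = 0 $ n"
    proof cases
      case 4
      have X2: "fps_X\<^sup>2 = fps_X * fps_X" "fps_X ^ 3 = fps_X * (fps_X * fps_X)"
        by (simp_all add: power2_eq_square power3_eq_cube mult.assoc)
      show ?thesis using t_rec[of "Suc (Suc m)"] unfolding 4 X2 mult.assoc
        by (simp add: power2_eq_square power3_eq_cube) (simp add: algebra_simps)
    next
      case 3
      show ?thesis using t_rec[of 1] t_rec[of 0] unfolding 3
        by (simp add: power2_eq_square power3_eq_cube mult.assoc numeral_2_eq_2)
    next
      case 2
      show ?thesis using t_rec[of 0] unfolding 2
        by (simp add: power2_eq_square power3_eq_cube mult.assoc)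
    qed simp
  qed
qed

section \<open>Convergence\<close>

text \<open>Serves both the Eisenstein series and the logarithm of the Euler product. The bound on
  \<open>c\<close> makes the double series absolutely convergent, so it may be summed by rows or
  regrouped by the exponent.\<close>

lemma Lambert_sums:
  fixes q :: complex and c :: "nat \<Rightarrow> nat \<Rightarrow> complex"
  assumes q: "norm q < 1" and c: "\<And>j k. norm (c (Suc j) (Suc k)) \<le> of_nat (Suc j)"
    and inner: "\<And>j. (\<lambda>k. c (Suc j) (Suc k) * q ^ (Suc j * Suc k)) sums h j"
  shows "\<exists>T. h sums T \<and> (\<lambda>n. (if n = 0 then 0 else \<Sum>m | m dvd n. c m (n div m)) * q ^ n) sums T"
proof -
  define r where "r = norm q"
  have r: "0 \<le> r" "r < 1" using q by (auto simp: r_def)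
  define F where "F = (\<lambda>(j, k). c (Suc j) (Suc k) * q ^ (Suc j * Suc k))"
  define G where "G = (\<lambda>(j, k). of_nat (Suc j) * r ^ (Suc j * Suc k))"
  have FG: "norm (F p) \<le> G p" for p
    using c by (cases p) (auto simp: F_def G_def norm_mult norm_power r_def intro!: mult_right_mono simp del: of_nat_Suc mult_Suc mult_Suc_right)
  have rj: "r ^ Suc j < 1" "r ^ Suc j \<le> r" for j
    using r power_Suc_less_one[of r j] power_decreasing[of 1 "Suc j" r] by (cases "r = 0", auto)
  have sumsG: "(\<lambda>k. G (j, k)) sums (of_nat (Suc j) * (r ^ Suc j / (1 - r ^ Suc j)))" for j
  proof -
    have "(\<lambda>k. (r ^ Suc j) ^ k) sums (1 / (1 - r ^ Suc j))"
      using rj r by (intro geometric_sums) (simp add: abs_of_nonneg)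
    from sums_mult[OF this, of "of_nat (Suc j) * r ^ Suc j"] show ?thesis
      by (simp add: G_def power_mult[symmetric] power_add[symmetric] mult.assoc del: of_nat_Suc power_Suc)
  qed
  have hsG: "((\<lambda>k. G (j, k)) has_sum (of_nat (Suc j) * (r ^ Suc j / (1 - r ^ Suc j)))) UNIV" for j
    by (rule sums_nonneg_imp_has_sum[OF sumsG]) (use r in \<open>auto simp: G_def\<close>)
  \<comment> \<open>The row sums of the majorant are at most (j + 1) r^(j + 1) / (1 - r), a
    derivative of the geometric series up to constants.\<close>
  have "(\<lambda>j. of_nat (Suc j) * (r ^ Suc j / (1 - r ^ Suc j))) summable_on UNIV"
  proof (rule summable_on_comparison_test)
    have "summable (\<lambda>j. r * (of_nat (Suc j) * r ^ j))"
      using r by (intro summable_mult sums_summable[OF geometric_deriv_sums]) auto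
    then have "summable (\<lambda>j. of_nat (Suc j) * r ^ Suc j)" by (simp add: mult_ac)
    then have "summable (\<lambda>j. of_nat (Suc j) * r ^ Suc j / (1 - r))" by (rule summable_divide)
    then show "(\<lambda>j. of_nat (Suc j) * r ^ Suc j / (1 - r)) summable_on UNIV"
      by (rule summable_nonneg_imp_summable_on) (use r in \<open>auto\<close>)
    show "of_nat (Suc j) * (r ^ Suc j / (1 - r ^ Suc j)) \<le> of_nat (Suc j) * r ^ Suc j / (1 - r)" for j
      using rj[of j] r
      by (simp add: times_divide_eq_right[symmetric] divide_left_mono mult_left_mono del: of_nat_Suc power_Suc times_divide_eq_right)
    show "0 \<le> of_nat (Suc j) * (r ^ Suc j / (1 - r ^ Suc j))" for j using rj[of j] r by (auto intro!: mult_nonneg_nonneg divide_nonneg_pos)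
  qed
  then have "G summable_on UNIV \<times> UNIV"
    by (rule summable_on_SigmaI[OF hsG]) (use r in \<open>auto simp: G_def\<close>)
  then have "(\<lambda>p. norm (F p)) summable_on UNIV \<times> UNIV"
    by (rule summable_on_comparison_test) (use FG in auto)
  then obtain T where T: "(F has_sum T) (UNIV \<times> UNIV)"
    using abs_summable_summable summable_on_def by blast
  have "(h has_sum T) UNIV"
  proof (rule has_sum_SigmaD[OF T])
    fix j
    show "((\<lambda>k. F (j, k)) has_sum h j) UNIV"
    proof (rule norm_summable_imp_has_sum)
      show "(\<lambda>k. F (j, k)) sums h j" using inner[of j] by (simp add: F_def)
      show "summable (\<lambda>k. norm (F (j, k)))"
        by (rule summable_comparison_test'[OF sums_summable[OF sumsG[of j]], of 0]) (use FG in auto)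
    qed
  qed
  then have h: "h sums T" by (rule has_sum_imp_sums)
  \<comment> \<open>Pairs of positive integers correspond to a positive \<open>n\<close> with a
    divisor \<open>m\<close>; the shifts by one translate from indices starting at 0.\<close>
  have "((\<lambda>(n, m). c m (n div m) * q ^ n) has_sum T) (Sigma {0<..} (\<lambda>n. {m. m dvd n})) \<longleftrightarrow>
     (F has_sum T) (UNIV \<times> UNIV)"
  proof (rule has_sum_reindex_bij_witness[where j = "\<lambda>(n, m). (m - 1, n div m - 1)"
        and i = "\<lambda>(j, k). (Suc j * Suc k, Suc j)"])
    fix a :: "nat \<times> nat" assume "a \<in> Sigma {0<..} (\<lambda>n. {m. m dvd n})"
    then obtain m k where a: "a = (m * k, m)" "m * k > 0" unfolding dvd_def by blast
    then have "m > 0" "k > 0" by auto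
    with a show "(case case a of (n, m) \<Rightarrow> (m - 1, n div m - 1) of (j, k) \<Rightarrow> (Suc j * Suc k, Suc j)) = a"
      and "F (case a of (n, m) \<Rightarrow> (m - 1, n div m - 1)) = (case a of (n, m) \<Rightarrow> c m (n div m) * q ^ n)"
      by (simp_all add: F_def del: mult_Suc mult_Suc_right)
  qed (auto simp del: mult_Suc mult_Suc_right)
  with T have "((\<lambda>(n, m). c m (n div m) * q ^ n) has_sum T) (Sigma {0<..} (\<lambda>n. {m. m dvd n}))" by simp
  then have "((\<lambda>n. (\<Sum>m | m dvd n. c m (n div m)) * q ^ n) has_sum T) {0<..}"
    by (rule has_sum_SigmaD) (auto intro!: has_sum_finiteI simp: sum_distrib_right)
  then have "((\<lambda>n. (if n = 0 then 0 else \<Sum>m | m dvd n. c m (n div m)) * q ^ n) has_sum T) UNIV"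
    by (subst has_sum_cong_neutral[where S = UNIV and T = "{0<..}"]) auto
  with h show ?thesis by (auto dest: has_sum_imp_sums)
qed

lemma eis_P_sums:
  assumes "norm q < 1"
  shows "(\<lambda>n. (1 - 24 * div_sum 1 1) $ n * q ^ n) sums eis_P q"
proof -
  have sm: "(\<lambda>k. of_nat (Suc j) * q ^ (Suc j * Suc k)) sums (of_nat (Suc j) * q ^ Suc j / (1 - q ^ Suc j))" for j
  proof -
    have "norm (q ^ Suc j) < 1" using assms by (simp add: norm_power power_less_one_iff del: power_Suc)
    from sums_mult[OF geometric_sums[OF this], of "of_nat (Suc j) * q ^ Suc j"] show ?thesis
      by (simp add: power_mult[symmetric] power_add[symmetric] mult.assoc del: of_nat_Suc power_Suc)
  qed
  have "norm (of_nat (Suc j) :: complex) \<le> of_nat (Suc j)" for j by (simp only: norm_of_nat)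
  from Lambert_sums[where c = "\<lambda>m k. of_nat m", OF assms this sm] obtain T where
    T: "(\<lambda>j. of_nat (Suc j) * q ^ Suc j / (1 - q ^ Suc j)) sums T"
    "(\<lambda>n. (if n = 0 then 0 else \<Sum>m | m dvd n. of_nat m) * q ^ n) sums T" by blast
  have "(\<lambda>n. div_sum 1 1 $ n * q ^ n) sums T"
  proof -
    have "div_sum 1 1 $ n = (if n = 0 then 0 else \<Sum>m | m dvd n. of_nat m)" for n
      by (simp add: lambert_fps_nth)
    then show ?thesis using T(2) by (simp only:)
  qed
  moreover have "(\<lambda>n. (1 :: complex fps) $ n * q ^ n) = (\<lambda>n. if n = 0 then 1 else 0)"
    by (auto simp: fun_eq_iff)
  then have "(\<lambda>n. (1 :: complex fps) $ n * q ^ n) sums 1" using sums_single[of 0 "\<lambda>_. 1 :: complex"] by simp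
  ultimately have "(\<lambda>n. (1 :: complex fps) $ n * q ^ n - 24 * (div_sum 1 1 $ n * q ^ n)) sums (1 - 24 * T)"
    by (intro sums_diff sums_mult)
  moreover have "eis_P q = 1 - 24 * T"
    using T(1) by (simp add: eis_P_def sums_iff)
  ultimately show ?thesis by (simp add: left_diff_distrib mult.assoc)
qed

text \<open>Expanding each logarithm puts weight \<open>- 1 / k\<close> on q^(m k); for
  \<open>n = m * k\<close> this is \<open>- m / n\<close>, and summing over the divisors gives the
  coefficient of \<open>log_euler\<close>.\<close>

lemma log_euler_sums:
  assumes "norm q < 1"
  shows "summable (\<lambda>n. log_euler $ n * q ^ n)"
    and "(\<lambda>j. Ln (1 - q ^ Suc j)) sums eval_fps log_euler q"
proof -
  have sm: "(\<lambda>k. (- 1 / of_nat (Suc k)) * q ^ (Suc j * Suc k)) sums Ln (1 - q ^ Suc j)" for j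
  proof -
    have "norm (- (q ^ Suc j)) < 1" using assms by (simp add: norm_power power_less_one_iff del: power_Suc)
    from Ln_series'[OF this] have "(\<lambda>n. - ((q ^ Suc j) ^ n) / of_nat n) sums Ln (1 - q ^ Suc j)" by simp
    then have "(\<lambda>n. - ((q ^ Suc j) ^ Suc n) / of_nat (Suc n)) sums Ln (1 - q ^ Suc j)"
      by (subst sums_Suc_iff) simp
    then show ?thesis by (simp only: power_mult) simp
  qed
  have "norm (- 1 / of_nat (Suc k) :: complex) \<le> of_nat (Suc j)" for j k
  proof -
    have "norm (- 1 / of_nat (Suc k) :: complex) = 1 / real (Suc k)"
      by (simp only: norm_divide norm_minus_cancel norm_one norm_of_nat)
    also have "\<dots> \<le> 1" by simp
    finally show ?thesis by simp
  qed
  from Lambert_sums[where c = "\<lambda>m k. - 1 / of_nat k", OF assms this sm] obtain T where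
    T: "(\<lambda>j. Ln (1 - q ^ Suc j)) sums T"
    "(\<lambda>n. (if n = 0 then 0 else \<Sum>m | m dvd n. - 1 / of_nat (n div m)) * q ^ n) sums T" by blast
  have "(if n = 0 then 0 else \<Sum>m | m dvd n. - 1 / of_nat (n div m)) = log_euler $ n" for n
  proof (cases "n = 0")
    case False
    have "- 1 / of_nat (n div m) = - (of_nat m / of_nat n :: complex)" if "m dvd n" for m
      using that False by (auto elim!: dvdE)
    with False show ?thesis
      by (simp add: log_euler_def lambert_fps_nth sum_divide_distrib sum_negf)
  qed simp
  with T(2) have 2: "(\<lambda>n. log_euler $ n * q ^ n) sums T" by simp
  with T(1) show "summable (\<lambda>n. log_euler $ n * q ^ n)" "(\<lambda>j. Ln (1 - q ^ Suc j)) sums eval_fps log_euler q"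
    by (simp_all add: sums_iff eval_fps_def)
qed

section \<open>Taylor expansions at 0, and passage from formal to convergent identities\<close>

lemma eventually_norm_less_1: "eventually (\<lambda>q :: complex. norm q < 1) (nhds 0)"
  by (rule eventually_nhds_in_open[of "ball 0 1", THEN eventually_mono]) auto

lemma log_euler_expansion: "eval_fps log_euler has_fps_expansion log_euler"
proof (rule has_fps_expansionI)
  show "eventually (\<lambda>q. (\<lambda>n. log_euler $ n * q ^ n) sums eval_fps log_euler q) (nhds 0)"
    using eventually_norm_less_1
    by eventually_elim (use log_euler_sums(1) in \<open>auto simp: eval_fps_def summable_sums\<close>)
qed

lemma log_euler_power_expansion:
  assumes "k > 0"
  shows "(\<lambda>q. eval_fps log_euler (q ^ k)) has_fps_expansion (log_euler oo fps_X ^ k)"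
  using has_fps_expansion_compose[OF log_euler_expansion has_fps_expansion_fps_X_power[of k]] assms
  by (simp add: o_def)

lemma exp_Ln_1_minus_power:
  assumes "norm q < 1" "k > 0"
  shows "exp (Ln (1 - (q :: complex) ^ k)) = 1 - q ^ k"
proof -
  have "norm (q ^ k) < 1" using assms by (simp add: norm_power power_less_one_iff)
  then have "1 - q ^ k \<noteq> 0" by auto
  then show ?thesis by (rule exp_Ln)
qed

lemma log_euler_power_sums:
  assumes "norm q < 1" "k > 0"
  shows "(\<lambda>j. Ln (1 - q ^ (k * Suc j))) sums eval_fps log_euler (q ^ k)"
  using log_euler_sums(2)[of "q ^ k"] assms
  by (simp add: norm_power power_less_one_iff power_mult del: power_Suc mult_Suc_right)

text \<open>The exponential turns the convergent sum of principal logarithms into the product; no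
  branch question arises since \<open>exp\<close> inverts \<open>Ln\<close> on nonzero
  arguments.\<close>

lemma mod_z_eq_exp:
  assumes "norm q < 1"
  shows "mod_z q = exp (4 * eval_fps log_euler (q ^ 1) + 4 * eval_fps log_euler (q ^ 3)
     - 2 * eval_fps log_euler (q ^ 2) - 2 * eval_fps log_euler (q ^ 6))"
proof -
  let ?L = "\<lambda>k j. Ln (1 - q ^ (k * Suc j))"
  have "(\<lambda>j. 4 * ?L 1 j + 4 * ?L 3 j - 2 * ?L 2 j - 2 * ?L 6 j) sums
    (4 * eval_fps log_euler (q ^ 1) + 4 * eval_fps log_euler (q ^ 3)
     - 2 * eval_fps log_euler (q ^ 2) - 2 * eval_fps log_euler (q ^ 6))"
    by (intro sums_add sums_diff sums_mult log_euler_power_sums assms) auto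
  then have "(\<Prod>j. exp (4 * ?L 1 j + 4 * ?L 3 j - 2 * ?L 2 j - 2 * ?L 6 j)) =
     exp (4 * eval_fps log_euler (q ^ 1) + 4 * eval_fps log_euler (q ^ 3)
     - 2 * eval_fps log_euler (q ^ 2) - 2 * eval_fps log_euler (q ^ 6))"
    by (subst prodinf_exp) (auto simp: sums_iff)
  moreover have "exp (4 * ?L 1 j + 4 * ?L 3 j - 2 * ?L 2 j - 2 * ?L 6 j) =
     ((1 - q ^ Suc j) ^ 4 * (1 - q ^ (3 * Suc j)) ^ 4) / ((1 - q ^ (2 * Suc j)) ^ 2 * (1 - q ^ (6 * Suc j)) ^ 2)" for j
    using assms by (simp add: exp_diff exp_add exp_Ln_1_minus_power exp_of_nat_mult[of 4, simplified] exp_of_nat_mult[of 2, simplified] del: power_Suc mult_Suc_right)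
  ultimately show ?thesis by (simp add: mod_z_def)
qed

lemma mod_y_eq_exp:
  assumes "norm q < 1"
  shows "mod_y q = q * exp (6 * eval_fps log_euler (q ^ 2) + 6 * eval_fps log_euler (q ^ 6)
     - 6 * eval_fps log_euler (q ^ 1) - 6 * eval_fps log_euler (q ^ 3))"
proof -
  let ?L = "\<lambda>k j. Ln (1 - q ^ (k * Suc j))"
  have "(\<lambda>j. 6 * ?L 2 j + 6 * ?L 6 j - 6 * ?L 1 j - 6 * ?L 3 j) sums
    (6 * eval_fps log_euler (q ^ 2) + 6 * eval_fps log_euler (q ^ 6)
     - 6 * eval_fps log_euler (q ^ 1) - 6 * eval_fps log_euler (q ^ 3))"
    by (intro sums_add sums_diff sums_mult log_euler_power_sums assms) auto
  then have "(\<Prod>j. exp (6 * ?L 2 j + 6 * ?L 6 j - 6 * ?L 1 j - 6 * ?L 3 j)) =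
     exp (6 * eval_fps log_euler (q ^ 2) + 6 * eval_fps log_euler (q ^ 6)
     - 6 * eval_fps log_euler (q ^ 1) - 6 * eval_fps log_euler (q ^ 3))"
    by (subst prodinf_exp) (auto simp: sums_iff)
  moreover have "exp (6 * ?L 2 j + 6 * ?L 6 j - 6 * ?L 1 j - 6 * ?L 3 j) =
     ((1 - q ^ (2 * Suc j)) ^ 6 * (1 - q ^ (6 * Suc j)) ^ 6) / ((1 - q ^ Suc j) ^ 6 * (1 - q ^ (3 * Suc j)) ^ 6)" for j
    using assms by (simp add: exp_diff exp_add exp_Ln_1_minus_power exp_of_nat_mult[of 6, simplified] del: power_Suc mult_Suc_right)
  ultimately show ?thesis by (simp add: mod_y_def)
qed

lemma has_fps_expansion_cong_ev:
  assumes "f has_fps_expansion F" "eventually (\<lambda>q. f q = g q) (nhds 0)"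
  shows "g has_fps_expansion F"
  using assms unfolding has_fps_expansion_def by (auto elim: eventually_elim2)

lemma mod_z_expansion: "mod_z has_fps_expansion z_fps"
proof (rule has_fps_expansion_cong_ev)
  let ?g = "\<lambda>q. 4 * eval_fps log_euler (q ^ 1) + 4 * eval_fps log_euler (q ^ 3)
     - 2 * eval_fps log_euler (q ^ 2) - 2 * eval_fps log_euler (q ^ 6)"
  have "?g has_fps_expansion (4 * (log_euler oo fps_X ^ 1) + 4 * (log_euler oo fps_X ^ 3)
     - 2 * (log_euler oo fps_X ^ 2) - 2 * (log_euler oo fps_X ^ 6))"
    by (intro has_fps_expansion_add has_fps_expansion_diff has_fps_expansion_mult has_fps_expansion_numeral
        log_euler_power_expansion) auto
  from has_fps_expansion_compose[OF has_fps_expansion_exp1 this]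
  show "(exp \<circ> ?g) has_fps_expansion z_fps" by (simp add: z_fps_def)
  show "eventually (\<lambda>q. (exp \<circ> ?g) q = mod_z q) (nhds 0)"
    using eventually_norm_less_1 by eventually_elim (simp add: mod_z_eq_exp)
qed

lemma mod_y_expansion: "mod_y has_fps_expansion y_fps"
proof (rule has_fps_expansion_cong_ev)
  let ?g = "\<lambda>q. 6 * eval_fps log_euler (q ^ 2) + 6 * eval_fps log_euler (q ^ 6)
     - 6 * eval_fps log_euler (q ^ 1) - 6 * eval_fps log_euler (q ^ 3)"
  have "?g has_fps_expansion (6 * (log_euler oo fps_X ^ 2) + 6 * (log_euler oo fps_X ^ 6)
     - 6 * (log_euler oo fps_X ^ 1) - 6 * (log_euler oo fps_X ^ 3))"
    by (intro has_fps_expansion_add has_fps_expansion_diff has_fps_expansion_mult has_fps_expansion_numeral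
        log_euler_power_expansion) auto
  from has_fps_expansion_compose[OF has_fps_expansion_exp1 this]
  have "(exp \<circ> ?g) has_fps_expansion (fps_exp 1 oo (6 * (log_euler oo fps_X ^ 2) + 6 * (log_euler oo fps_X ^ 6)
     - 6 * (log_euler oo fps_X ^ 1) - 6 * (log_euler oo fps_X ^ 3)))" by simp
  from has_fps_expansion_mult[OF has_fps_expansion_fps_X this]
  show "(\<lambda>q. q * (exp \<circ> ?g) q) has_fps_expansion y_fps" by (simp only: y_fps_def)
  show "eventually (\<lambda>q. q * (exp \<circ> ?g) q = mod_y q) (nhds 0)"
    using eventually_norm_less_1 by eventually_elim (simp add: mod_y_eq_exp)
qed

lemma mod_Z_expansion: "mod_Z has_fps_expansion Z_fps"
  unfolding mod_Z_def[abs_def] Z_fps_def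
  by (intro has_fps_expansion_add has_fps_expansion_mult has_fps_expansion_numeral has_fps_expansion_1
      mod_y_expansion mod_z_expansion)

lemma mod_x_expansion: "mod_x has_fps_expansion x_fps"
  unfolding mod_x_def[abs_def] x_fps_def divide_inverse
  by (intro has_fps_expansion_mult has_fps_expansion_inverse has_fps_expansion_add has_fps_expansion_numeral
      has_fps_expansion_1 mod_y_expansion) simp

lemma eis_P_expansion: "eis_P has_fps_expansion (1 - 24 * div_sum 1 1)"
  by (rule has_fps_expansionI, rule eventually_mono[OF eventually_norm_less_1], rule eis_P_sums)

lemma eis_P_power_expansion:
  assumes "k > 0"
  shows "(\<lambda>q. eis_P (q ^ k)) has_fps_expansion (1 - 24 * div_sum 1 k)"
  using has_fps_expansion_compose[OF eis_P_expansion has_fps_expansion_fps_X_power[of k]] assms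
  by (simp add: o_def fps_compose_sub_distrib fps_compose_mult_distrib div_sum_compose[of k _ 1, simplified])

lemma has_fps_expansion_eventually_eq:
  assumes "f has_fps_expansion F" "g has_fps_expansion F"
  shows "eventually (\<lambda>q. f q = g q) (nhds 0)"
  using assms unfolding has_fps_expansion_def by (auto elim: eventually_elim2)

text \<open>Since \<open>v\<close> is continuous with value 0 at 0, it stays inside the disc of
  convergence of \<open>F\<close> near 0, where the formal composition is a genuine sum.\<close>

lemma eventually_sums_compose:
  fixes v Y :: "complex \<Rightarrow> complex"
  assumes v: "v has_fps_expansion V" "V $ 0 = 0" and F: "fps_conv_radius F > 0"
    and Y: "Y has_fps_expansion (F oo V)"
  shows "eventually (\<lambda>q. (\<lambda>n. F $ n * v q ^ n) sums Y q) (nhds 0)"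
proof -
  have "(eval_fps F \<circ> v) has_fps_expansion (F oo V)"
    using F v by (intro has_fps_expansion_compose eval_fps_has_fps_expansion)
  from has_fps_expansion_eventually_eq[OF this Y]
  have "eventually (\<lambda>q. eval_fps F (v q) = Y q) (nhds 0)" by simp
  moreover have "v 0 = 0" using v has_fps_expansion_imp_0_eq_fps_nth_0 by metis
  then have "(v \<longlongrightarrow> 0) (nhds 0)"
    using has_fps_expansion_imp_continuous[OF v(1), of UNIV]
    by (simp add: continuous_within tendsto_nhds_iff)
  then have "eventually (\<lambda>q. v q \<in> eball 0 (fps_conv_radius F)) (nhds 0)"
    by (rule topological_tendstoD) (use F in \<open>auto simp: zero_ereal_def\<close>)
  ultimately show ?thesis
    by eventually_elim (use sums_eval_fps in \<open>fastforce simp: in_eball_iff\<close>)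
qed

section \<open>Geometric bounds for the three coefficient sequences\<close>

lemma fps_conv_radius_pos_of_geometric_bound:
  fixes a :: "nat \<Rightarrow> complex" and C :: real
  assumes "C > 0" "\<And>n. norm (a n) \<le> C ^ n"
  shows "fps_conv_radius (Abs_fps a) > 0"
proof -
  have "summable (\<lambda>n. a n * of_real (1 / (2 * C)) ^ n)"
  proof (rule summable_comparison_test')
    show "summable (\<lambda>n. (1 / 2 :: real) ^ n)" by (rule summable_geometric) simp
    fix n
    have "norm (a n * of_real (1 / (2 * C)) ^ n) \<le> C ^ n * (1 / (2 * C)) ^ n"
      using assms by (simp add: norm_mult norm_power norm_divide mult_right_mono divide_right_mono)
    also have "\<dots> = (1 / 2) ^ n" using assms(1) by (simp add: power_mult_distrib[symmetric])
    finally show "norm (a n * of_real (1 / (2 * C)) ^ n) \<le> (1 / 2) ^ n" .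
  qed
  from conv_radius_geI[OF this] have "ereal (1 / (2 * C)) \<le> conv_radius a" using assms(1) by (simp add: norm_divide)
  moreover have "ereal 0 < ereal (1 / (2 * C))" using assms(1) by simp
  ultimately show ?thesis unfolding fps_conv_radius_def
    by (metis (no_types) fps_nth_Abs_fps less_le_trans zero_ereal_def ext)
qed

text \<open>Bounding binomials by powers of 2 gives 16^n for each summand, and the number
  \<open>n + 1\<close> of summands is at most 2^n.\<close>

lemma domb_le: "domb n \<le> 32 ^ n"
proof -
  have "domb n \<le> (\<Sum>j=0..n. 16 ^ n)"
    unfolding domb_def
  proof (rule sum_mono)
    fix j assume j: "j \<in> {0..n}"
    have "(n choose j)\<^sup>2 * ((2 * j) choose j) * ((2 * n - 2 * j) choose (n - j)) \<le>
       (2 ^ n)\<^sup>2 * 2 ^ (2 * j) * 2 ^ (2 * n - 2 * j)"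
      by (intro mult_le_mono power_mono binomial_le_pow2) auto
    also have "\<dots> = 16 ^ n"
    proof -
      have "(2 ^ n)\<^sup>2 * 2 ^ (2 * j) * 2 ^ (2 * n - 2 * j) = (2 :: nat) ^ (2 * n + 2 * j + (2 * n - 2 * j))"
        by (simp add: power_add power_mult[symmetric] mult.commute)
      also have "2 * n + 2 * j + (2 * n - 2 * j) = 4 * n" using j by auto
      also have "(2 :: nat) ^ (4 * n) = 16 ^ n" by (simp add: power_mult)
      finally show ?thesis .
    qed
    finally show "(n choose j)\<^sup>2 * ((2 * j) choose j) * ((2 * n - 2 * j) choose (n - j)) \<le> 16 ^ n" .
  qed
  also have "\<dots> = (n + 1) * 16 ^ n" by simp
  also have "\<dots> \<le> 2 ^ n * 16 ^ n"
    by (intro mult_right_mono) (use less_exp[of n] in \<open>auto simp: Suc_le_eq\<close>)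
  also have "\<dots> = 32 ^ n" by (simp add: power_mult_distrib[symmetric])
  finally show ?thesis .
qed

lemma hypergeom_coeff_le: "((3 * n) choose n) * ((2 * n) choose n)\<^sup>2 \<le> 128 ^ n"
proof -
  have "((3 * n) choose n) * ((2 * n) choose n)\<^sup>2 \<le> 2 ^ (3 * n) * (2 ^ (2 * n))\<^sup>2"
    by (intro mult_le_mono power_mono binomial_le_pow2) auto
  also have "\<dots> = 128 ^ n"
    by (simp add: power_mult power2_eq_square power_mult_distrib[symmetric])
  finally show ?thesis .
qed

lemma t_bound:
  fixes t :: "nat \<Rightarrow> complex"
  assumes t_0: "t 0 = 1"
    and t_rec: "\<And>n. of_nat (n + 1) ^ 3 * t (n + 1) =
        - 2 * of_nat n * of_nat (n + 1) * of_nat (2 * n + 1) * t n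
        + 16 * of_nat n * (5 * of_nat n ^ 2 + 1) * t (n - 1)
        - 96 * of_nat n * (of_nat n - 1) * (2 * of_nat n - 1) * t (n - 2)"
  shows "norm (t n) \<le> 276 ^ n"
proof (induction n rule: less_induct)
  case (less n)
  show ?case
  proof (cases n)
    case (Suc m)
    have le: "norm (t k) \<le> 276 ^ m" if "k \<le> m" for k
      using less.IH[of k] that Suc power_increasing[of k m "276 :: real"] by (simp del: power_increasing_iff)
    define N where "N = real m"
    have N: "N \<ge> 0" "of_nat m = complex_of_real N" "m = 0 \<longrightarrow> N = 0" "m > 0 \<longrightarrow> N \<ge> 1" by (auto simp: N_def)
    define A B C where "A = 2 * N * (N + 1) * (2 * N + 1)" and "B = 16 * N * (5 * N ^ 2 + 1)"
      and "C = 96 * N * (N - 1) * (2 * N - 1)"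
    \<comment> \<open>For \<open>C\<close> this uses that \<open>N\<close> is an integer: (N - 1) (2
      N - 1) is negative only strictly between 1/2 and 1.\<close>
    have ABC: "A \<ge> 0" "B \<ge> 0" "C \<ge> 0"
      using N by (cases "m = 0"; auto simp: A_def B_def C_def)+
    \<comment> \<open>276 = 4 + 80 + 192 is the sum of the leading coefficients of \<open>A\<close>,
      \<open>B\<close> and \<open>C\<close>.\<close>
    have sum: "A + B + C \<le> 276 * (N + 1) ^ 3"
      using N(1) by (simp add: A_def B_def C_def power2_eq_square power3_eq_cube algebra_simps)
    have "of_real ((N + 1) ^ 3) * t (Suc m) = - of_real A * t m + of_real B * t (m - 1) - of_real C * t (m - 2)"
      using t_rec[of m] by (simp add: N(2) A_def B_def C_def algebra_simps)
    then have "norm (of_real ((N + 1) ^ 3) * t (Suc m)) \<le>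
       norm (of_real A * t m) + norm (of_real B * t (m - 1)) + norm (of_real C * t (m - 2))"
      by (smt (verit, best) mult_minus_left norm_minus_cancel norm_triangle_ineq norm_triangle_ineq4)
    also have "\<dots> \<le> A * 276 ^ m + B * 276 ^ m + C * 276 ^ m"
      using ABC le by (simp add: norm_mult add_mono mult_left_mono)
    also have "\<dots> = (A + B + C) * 276 ^ m" by (simp add: algebra_simps)
    also have "\<dots> \<le> 276 * (N + 1) ^ 3 * 276 ^ m" using sum by (intro mult_right_mono) auto
    finally have "(N + 1) ^ 3 * norm (t (Suc m)) \<le> (N + 1) ^ 3 * 276 ^ Suc m"
      using N(1) by (simp add: norm_mult norm_of_real mult_ac del: of_real_power of_real_add)
    moreover have "(N + 1) ^ 3 > 0" using N(1) by simp
    ultimately show ?thesis using Suc by simp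
  qed (simp add: t_0)
qed

theorem theorem6p4:
  fixes t :: "nat \<Rightarrow> complex"
  assumes t_0: "t 0 = 1"
    and t_rec: "\<And>n. of_nat (n + 1) ^ 3 * t (n + 1) =
        - 2 * of_nat n * of_nat (n + 1) * of_nat (2 * n + 1) * t n
        + 16 * of_nat n * (5 * of_nat n ^ 2 + 1) * t (n - 1)
        - 96 * of_nat n * (of_nat n - 1) * (2 * of_nat n - 1) * t (n - 2)"
  shows "\<forall>\<^sub>F q in nhds (0 :: complex).
      mod_Z q = (3 * eis_P (q ^ 6) - eis_P (q ^ 2)) / 2 \<and>
      (\<lambda>n. t n * mod_x q ^ n) sums mod_Z q \<and>
      (\<lambda>n. (-1) ^ n * of_nat (domb n) * (mod_x q ^ n / (1 - 4 * mod_x q) ^ (n + 1)))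
        sums mod_Z q \<and>
      (\<lambda>n. of_nat (((3 * n) choose n) * ((2 * n) choose n)\<^sup>2) *
            mod_x q ^ (2 * n) * (1 - 4 * mod_x q) ^ n) sums mod_Z q"
proof -
  have "(\<lambda>q. 3 * eis_P (q ^ 6) - eis_P (q ^ 2)) has_fps_expansion
      (3 * (1 - 24 * div_sum 1 6) - (1 - 24 * div_sum 1 2))"
    by (intro has_fps_expansion_diff has_fps_expansion_mult has_fps_expansion_numeral eis_P_power_expansion) auto
  also have "3 * (1 - 24 * div_sum 1 6) - (1 - 24 * div_sum 1 2) = 2 * Z_fps"
    by (simp add: Z_fps_eq algebra_simps)
  finally have 1: "eventually (\<lambda>q. 3 * eis_P (q ^ 6) - eis_P (q ^ 2) = 2 * mod_Z q) (nhds 0)"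
    by (rule has_fps_expansion_eventually_eq) (intro has_fps_expansion_mult has_fps_expansion_numeral mod_Z_expansion)
  have 2: "eventually (\<lambda>q. (\<lambda>n. t n * mod_x q ^ n) sums mod_Z q) (nhds 0)"
    using eventually_sums_compose[OF mod_x_expansion x_fps_0, of "Abs_fps t" mod_Z]
      fps_conv_radius_pos_of_geometric_bound[of 276 t] t_bound[OF t_0 t_rec]
      mod_Z_expansion Z_fps_eq_t[OF t_0 t_rec] by simp
  \<comment> \<open>The Domb series is first obtained for z in powers of y; the form in x follows at
    the end.\<close>
  have 3: "eventually (\<lambda>q. (\<lambda>n. (-1) ^ n * of_nat (domb n) * mod_y q ^ n) sums mod_z q) (nhds 0)"
  proof -
    have "fps_conv_radius (Abs_fps (\<lambda>n. (-1) ^ n * of_nat (domb n) :: complex)) > 0"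
    proof (rule fps_conv_radius_pos_of_geometric_bound)
      show "norm ((-1) ^ n * of_nat (domb n) :: complex) \<le> 32 ^ n" for n
        using of_nat_mono[OF domb_le[of n], where ?'a = real] by (simp add: norm_mult norm_power)
    qed simp
    from eventually_sums_compose[OF mod_y_expansion y_fps_0 this, of mod_z] mod_z_expansion z_fps_eq_domb
    show ?thesis by simp
  qed
  have 4: "eventually (\<lambda>q. (\<lambda>n. of_nat (((3 * n) choose n) * ((2 * n) choose n)\<^sup>2) *
      (mod_x q ^ 2 * (1 - 4 * mod_x q)) ^ n) sums mod_Z q) (nhds 0)"
  proof -
    have c: "fps_conv_radius (Abs_fps (\<lambda>n. of_nat (((3 * n) choose n) * ((2 * n) choose n)\<^sup>2) :: complex)) > 0"
    proof (rule fps_conv_radius_pos_of_geometric_bound)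
      show "norm (of_nat (((3 * n) choose n) * ((2 * n) choose n)\<^sup>2) :: complex) \<le> 128 ^ n" for n
        using of_nat_mono[OF hypergeom_coeff_le[of n], where ?'a = real] by (simp only: norm_of_nat of_nat_power of_nat_numeral)
    qed simp
    have "(\<lambda>q. mod_x q ^ 2 * (1 - 4 * mod_x q)) has_fps_expansion (x_fps\<^sup>2 * (1 - 4 * x_fps))"
      unfolding power2_eq_square
      by (intro has_fps_expansion_diff has_fps_expansion_mult has_fps_expansion_numeral has_fps_expansion_1 mod_x_expansion)
    from eventually_sums_compose[OF this _ c, of mod_Z] mod_Z_expansion Z_fps_eq_hypergeom
    show ?thesis by simp
  qed
  have 5: "eventually (\<lambda>q. (1 + 4 * mod_y q) * (1 - 4 * mod_x q) = 1) (nhds 0)"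
  proof (rule has_fps_expansion_eventually_eq)
    have "(\<lambda>q. (1 + 4 * mod_y q) * (1 - 4 * mod_x q)) has_fps_expansion ((1 + 4 * y_fps) * (1 - 4 * x_fps))"
      by (intro has_fps_expansion_add has_fps_expansion_diff has_fps_expansion_mult has_fps_expansion_numeral has_fps_expansion_1
          mod_x_expansion mod_y_expansion)
    then show "(\<lambda>q. (1 + 4 * mod_y q) * (1 - 4 * mod_x q)) has_fps_expansion 1"
      unfolding y_fps_conv_x .
  qed simp
  from 1 2 3 4 5 show ?thesis
  proof eventually_elim
    case (elim q)
    \<comment> \<open>A product equal to 1 has nonzero factors, so none of the divisions falls back
      on the default value.\<close>
    have nz: "1 - 4 * mod_x q \<noteq> 0" "1 + 4 * mod_y q \<noteq> 0" using elim(5) by auto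
    then have y: "1 + 4 * mod_y q = 1 / (1 - 4 * mod_x q)" using elim(5) by (subst nonzero_eq_divide_eq)
    have yx: "mod_y q = mod_x q / (1 - 4 * mod_x q)"
    proof -
      have "mod_x q / (1 - 4 * mod_x q) = mod_x q * (1 + 4 * mod_y q)" unfolding y by simp
      also have "\<dots> = mod_y q" using nz(2) by (simp add: mod_x_def)
      finally show ?thesis by (rule sym)
    qed
    \<comment> \<open>Multiplying by 1 + 4 y = 1 / (1 - 4 x) and substituting y = x / (1 - 4 x)
      produces the exponent \<open>n + 1\<close> in the denominator.\<close>
    have "(\<lambda>n. (1 + 4 * mod_y q) * ((-1) ^ n * of_nat (domb n) * mod_y q ^ n)) sums mod_Z q"
      unfolding mod_Z_def by (intro sums_mult elim)
    moreover have "(1 + 4 * mod_y q) * ((-1) ^ n * of_nat (domb n) * mod_y q ^ n) =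
        (-1) ^ n * of_nat (domb n) * (mod_x q ^ n / (1 - 4 * mod_x q) ^ (n + 1))" for n
      unfolding y unfolding yx by (simp add: power_divide)
    ultimately have "(\<lambda>n. (-1) ^ n * of_nat (domb n) * (mod_x q ^ n / (1 - 4 * mod_x q) ^ (n + 1))) sums mod_Z q"
      by simp
    moreover have "(\<lambda>n. of_nat (((3 * n) choose n) * ((2 * n) choose n)\<^sup>2) *
            mod_x q ^ (2 * n) * (1 - 4 * mod_x q) ^ n) sums mod_Z q"
      using elim(4) by (simp only: power_mult_distrib power_mult mult.assoc)
    ultimately show ?case using elim(1,2) by simp
  qed
qed

end
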